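(* Suppose $\gamma^0=\emptyset$, i.e. $\mathbf y=\epsilon\sim N(0,\sigma_0^2I_n)$, and that Assumptions A1, A5, A6, A7 and A8 hold, with $\delta\ge0$ the constant of Assumption A8. (i) If $p^{\alpha_0}=o(n^{1-\delta}\underline{\phi}_n)$ for some $\alpha_0>2$, then $\sup_{c_1,\ldots,c_p\in[\underline{\phi}_n,\bar{\phi}_n]}\max_{\gamma\neq\gamma^0}p(\gamma|Z)/p(\gamma^0|Z)\to0$ in probability. (ii) If $p^{\alpha_0+2}=o(n^{1-\delta}\underline{\phi}_n)$ for some $\alpha_0>2$, then $\sup_{c_1,\ldots,c_p\in[\underline{\phi}_n,\bar{\phi}_n]}\sum_{\gamma\neq\gamma^0}p(\gamma|Z)\to0$ in probability, and consequently $\inf_{c_1,\ldots,c_p\in[\underline{\phi}_n,\bar{\phi}_n]}p(\gamma^0|Z)\to1$ in probability.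
   Context: Setting. For each $n$, let $p=p_n$, let $X=(X_1,\dots,X_p)$ be an $n\times p$ design matrix, either deterministic or random and independent of $\epsilon$, such that all matrices $X_\gamma^TX_\gamma$ below are invertible (a.s.), and let the data be $\mathbf y=X\beta^0+\epsilon$ with $\epsilon\sim N(0,\sigma_0^2I_n)$ and $\beta^0\in\mathbb R^p$ ($X,\beta^0,p$ may depend on $n$); $Z=(\mathbf y,X)$. A model is a state vector $\gamma\in\{0,1\}^p$; $|\gamma|$ is its number of ones; $X_\gamma$ (resp. $\beta_\gamma$) is the submatrix of columns of $X$ (resp. subvector of $\beta$) indexed by $\{j:\gamma_j=1\}$. The true model is $\gamma^0$ with $\gamma^0_j=I(\beta^0_j\neq0)$; $s_n=|\gamma^0|$; $k_n=\|\beta^0_{\gamma^0}\|_2^2$; $\emptyset$ is the zero vector (null model). For state vectors, $\gamma\setminus\gamma'$ has $j$-th entry $I(\gamma_j=1,\gamma'_j=0)$, and $\gamma\subset\gamma'$ means $\gamma\setminus\gamma'=0$. $P_\gamma=X_\gamma(X_\gamma^TX_\gamma)^{-1}X_\gamma^T$, $P_\emptyset=0$. $S_1=\{\gamma:\gamma^0\subset\gamma,\gamma\neq\gamma^0\}$. $\lambda_-(A)$ is the smallest eigenvalue. Bayesian model: $\mathbf y|\beta,\sigma^2\sim N(X\beta,\sigma^2I_n)$; independently $\beta_j|\gamma_j,\sigma^2\sim(1-\gamma_j)\delta_0+\gamma_jN(0,c_j\sigma^2)$ ($\delta_0$ point mass at 0, $c_j>0$ hyperparameters); $1/\sigma^2\sim\chi^2_\nu$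 with $\nu>0$ fixed; $\gamma\sim p(\gamma)$ a prior on $\{0,1\}^p$. Let $\Sigma=\mathrm{diag}(c_1,\dots,c_p)$, $\Sigma_\gamma$ its diagonal submatrix indexed by $\gamma$, $U_\gamma=\Sigma_\gamma^{-1}+X_\gamma^TX_\gamma$, $W_\gamma=\Sigma_\gamma^{1/2}U_\gamma\Sigma_\gamma^{1/2}$ (conventions $X_\emptyset=0$, $\Sigma_\emptyset=U_\emptyset=W_\emptyset=1$). The posterior model probability is $p(\gamma|Z)\propto\det(W_\gamma)^{-1/2}p(\gamma)\{1+\mathbf y^T(I_n-X_\gamma U_\gamma^{-1}X_\gamma^T)\mathbf y\}^{-(n+\nu)/2}$, normalized over all $\gamma\in\{0,1\}^p$. All limits are as $n\to\infty$. Assumptions. A1: there is $C_0>0$ with $\max_{\gamma}p(\gamma)/p(\gamma^0)\le C_0$ for all $n$. A5: $p\to\infty$, $s_n\le p\le n$, and $p\log p=o(n)$. A6: $\bar\phi_n=O(n^{\delta_0})$ for some $\delta_0>0$, and $\max_jc_j\le\bar\phi_n$. A7: $\underline\phi_n$ is a positive sequence with $k_n=O(\underline\phi_n)$ and $\min_jc_j\ge\underline\phi_n$. A8: there are $C_3>0$ and $\delta\ge0$ with $n^{1-\delta}\underline\phi_n\to\infty$ and, for every $n$, with probability one, $\inf_{\gamma\in S_1}\lambda_-\big(\frac1nX_{\gamma\setminus\gamma^0}^T(I_n-P_{\gamma^0})X_{\gamma\setminus\gamma^0}\big)\ge C_3n^{-\delta}$. *)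

theory Defs
  imports "HOL-Probability.Probability" "HOL-Library.Landau_Symbols"
    "Jordan_Normal_Form.Char_Poly" "Jordan_Normal_Form.DL_Submatrix"
    "Jordan_Normal_Form.Gauss_Jordan_Elimination"
begin

text \<open>Models gamma are subsets of the column index set {..<p}; the empty set is the null model.\<close>

definition mat_inv :: "real mat \<Rightarrow> real mat" where
  "mat_inv A = the (mat_inverse A)"

definition Xsub :: "real mat \<Rightarrow> nat set \<Rightarrow> real mat" where
  "Xsub X g = submatrix X {..<dim_row X} g"

definition Sigma_sub :: "(nat \<Rightarrow> real) \<Rightarrow> nat set \<Rightarrow> real mat" where
  "Sigma_sub c g = mat (card g) (card g) (\<lambda>(i,k). if i = k then c (pick g i) else 0)"

definition Sigma_sqrt_sub :: "(nat \<Rightarrow> real) \<Rightarrow> nat set \<Rightarrow> real mat" where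
  "Sigma_sqrt_sub c g = mat (card g) (card g) (\<lambda>(i,k). if i = k then sqrt (c (pick g i)) else 0)"

definition U_mat :: "real mat \<Rightarrow> (nat \<Rightarrow> real) \<Rightarrow> nat set \<Rightarrow> real mat" where
  "U_mat X c g = mat_inv (Sigma_sub c g) + transpose_mat (Xsub X g) * Xsub X g"

definition W_mat :: "real mat \<Rightarrow> (nat \<Rightarrow> real) \<Rightarrow> nat set \<Rightarrow> real mat" where
  "W_mat X c g = Sigma_sqrt_sub c g * U_mat X c g * Sigma_sqrt_sub c g"

text \<open>Projection P_gamma (P_empty = 0 automatically, as X_empty has no columns).\<close>
definition proj_mat :: "real mat \<Rightarrow> nat set \<Rightarrow> real mat" where
  "proj_mat X g = Xsub X g * mat_inv (transpose_mat (Xsub X g) * Xsub X g) * transpose_mat (Xsub X g)"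

text \<open>Unnormalised posterior model weight:
  det(W_gamma)^(-1/2) p(gamma) (1 + y^T (I - X_g U_g^{-1} X_g^T) y)^(-(n+nu)/2).
  For gamma empty all matrices are 0x0, so det W = 1 and the quadratic form is y^T y.\<close>
definition post_weight ::
  "real \<Rightarrow> (nat set \<Rightarrow> real) \<Rightarrow> real mat \<Rightarrow> real vec \<Rightarrow> (nat \<Rightarrow> real) \<Rightarrow> nat set \<Rightarrow> real" where
  "post_weight \<nu> prior X y c g =
     det (W_mat X c g) powr (-1/2) * prior g *
     (1 + y \<bullet> ((1\<^sub>m (dim_vec y) - Xsub X g * mat_inv (U_mat X c g) * transpose_mat (Xsub X g)) *\<^sub>v y))
       powr (- (real (dim_vec y) + \<nu>) / 2)"

definition posterior ::
  "nat \<Rightarrow> real \<Rightarrow> (nat set \<Rightarrow> real) \<Rightarrow> real mat \<Rightarrow> real vec \<Rightarrow> (nat \<Rightarrow> real) \<Rightarrow> nat set \<Rightarrow> real" where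
  "posterior p \<nu> prior X y c g =
     post_weight \<nu> prior X y c g / (\<Sum>h\<in>Pow {..<p}. post_weight \<nu> prior X y c h)"

text \<open>Independence of two random variables with (possibly) different value types;
  this unfolds exactly like the library's indep_var (which requires equal value types).\<close>
definition indep_rv :: "'a measure \<Rightarrow> 'b measure \<Rightarrow> ('a \<Rightarrow> 'b) \<Rightarrow> 'c measure \<Rightarrow> ('a \<Rightarrow> 'c) \<Rightarrow> bool" where
  "indep_rv M Ma A Mb B \<longleftrightarrow> A \<in> measurable M Ma \<and> B \<in> measurable M Mb \<and>
     prob_space.indep_set M {A -` S \<inter> space M | S. S \<in> sets Ma} {B -` S \<inter> space M | S. S \<in> sets Mb}"

definition lambda_min :: "real mat \<Rightarrow> real" where
  "lambda_min A = Min {k. eigenvalue A k}"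

text \<open>Convergence to zero of the (outer) probability of a sequence of events B n in M n.
  (Outer probability avoids any measurability requirement for events defined via suprema.)\<close>
definition outer_prob_to_zero :: "(nat \<Rightarrow> 'a measure) \<Rightarrow> (nat \<Rightarrow> 'a set) \<Rightarrow> bool" where
  "outer_prob_to_zero M B \<longleftrightarrow>
     (\<exists>A. (\<forall>n. A n \<in> sets (M n) \<and> B n \<subseteq> A n) \<and> (\<lambda>n. measure (M n) (A n)) \<longlonglongrightarrow> 0)"

end

theory Submission
  imports Defs
begin

text \<open>For \<open>g \<noteq> \<emptyset>\<close> let \<open>T\<close> be the squared norm of the projection of \<open>y\<close> onto the columns of \<open>X\<^sub>g\<close>.
  Whatever the \<open>c\<^sub>j\<close> are, the quadratic form in the posterior weight is at least \<open>|y|\<^sup>2 - T\<close> and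
  \<open>det W\<^sub>g \<ge> (C\<^sub>3 n\<^bsup>1-\<delta>\<^esup> \<phi>)\<^bsup>|g|\<^esup>\<close> (with \<open>\<phi>\<close> the lower bound for the \<open>c\<^sub>j\<close>), so the ratio of the weights of \<open>g\<close>
  and \<open>\<emptyset>\<close> is at most \<open>C\<^sub>0 (C\<^sub>3 n\<^bsup>1-\<delta>\<^esup> \<phi>)\<^bsup>-|g|/2\<^esup> exp ((n + \<nu>) T / (2 (|y|\<^sup>2 - T)))\<close>. Since \<open>T\<close> is \<open>\<sigma>\<^sup>2\<close> times a
  \<open>\<chi>\<^sup>2\<close> variable with \<open>|g|\<close> degrees of freedom, Chernoff's bound and a union bound over all models give
  \<open>T \<le> t \<sigma>\<^sup>2 |g| log p\<close> simultaneously, for any \<open>t > 2\<close>, while \<open>|y|\<^sup>2 \<ge> (1 - \<epsilon>) n \<sigma>\<^sup>2\<close>. On this event the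
  ratio is at most \<open>C\<^sub>0 r\<^bsup>|g|\<^esup>\<close> with \<open>r\<^sup>2 = p\<^bsup>\<alpha>\<^esup> / (C\<^sub>3 n\<^bsup>1-\<delta>\<^esup> \<phi>)\<close>, and \<open>\<Sum> r\<^bsup>|g|\<^esup> = (1 + r)\<^bsup>p\<^esup> - 1\<close>.

  The moment generating function of \<open>T\<close> is obtained without orthogonal changes of variables:
  \<open>exp (s T)\<close> is a quotient of two Gaussian integrals over the coefficient vector, jointly measurable in
  the design and the noise, and Tonelli's theorem allows integrating over the noise first.\<close>

subsection \<open>Gram matrices and posterior weights\<close>

text \<open>Pairing \<open>C^T C v = mu v\<close> with the conjugate of \<open>v\<close> gives mu
  |v|^2 = |C v|^2. The eigenvalue is taken over the complex numbers because that is where the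
  characteristic polynomial is known to split.\<close>

lemma gram_eigenvalue_nonneg:
  fixes C :: "real mat"
  assumes C: "C \<in> carrier_mat n m"
    and ev: "eigenvalue (map_mat complex_of_real (transpose_mat C * C)) \<mu>"
  shows "\<exists>r\<ge>0. \<mu> = complex_of_real r"
proof -
  let ?D = "map_mat complex_of_real C"
  have D: "?D \<in> carrier_mat n m" using C by simp
  have K: "map_mat complex_of_real (transpose_mat C * C) = transpose_mat ?D * ?D"
    by (subst of_real_hom.mat_hom_mult[of _ m n _ m]) (use C in \<open>auto simp: map_mat_transpose\<close>)
  from ev obtain v where v: "v \<in> carrier_vec m" "v \<noteq> 0\<^sub>v m"
    and e: "(transpose_mat ?D * ?D) *\<^sub>v v = \<mu> \<cdot>\<^sub>v v"
    unfolding eigenvalue_def eigenvector_def K using C by auto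
  define w where "w = ?D *\<^sub>v v"
  have w: "w \<in> carrier_vec n" unfolding w_def using D v by simp
  have cv: "conjugate v \<in> carrier_vec m" using v by simp
  have 1: "transpose_mat ?D *\<^sub>v w = \<mu> \<cdot>\<^sub>v v"
    unfolding w_def e[symmetric] using D v by (simp add: assoc_mult_mat_vec[of _ m n _ m])
  have "\<mu> * (v \<bullet>c v) = (transpose_mat ?D *\<^sub>v w) \<bullet> conjugate v"
    unfolding 1 using v cv by simp
  also have "\<dots> = w \<bullet> (?D *\<^sub>v conjugate v)"
    by (rule transpose_vec_mult_scalar[OF D cv w])
  also have "?D *\<^sub>v conjugate v = conjugate w"
    unfolding w_def using C v
    by (intro eq_vecI) (auto simp: scalar_prod_def)
  finally have 2: "\<mu> * (v \<bullet>c v) = w \<bullet>c w" .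
  have pos: "v \<bullet>c v > 0" using v by simp
  have ge: "w \<bullet>c w \<ge> 0" by (rule conjugate_square_ge_0_vec)
  obtain a where a: "v \<bullet>c v = complex_of_real a" "a > 0"
    using pos by (metis complex_is_Real_iff less_complex_def of_real_Re zero_complex.simps)
  obtain b where b: "w \<bullet>c w = complex_of_real b" "b \<ge> 0"
    using ge by (metis complex_is_Real_iff less_eq_complex_def of_real_Re zero_complex.simps)
  have "\<mu> = complex_of_real (b / a)" using 2 a b by (simp add: field_simps)
  thus ?thesis using a b by (intro exI[of _ "b/a"]) simp
qed

text \<open>The complex characteristic polynomial splits and its roots are real and nonnegative, so
  the real one splits with the same roots. The list of eigenvalues with multiplicity is enough for
  the two determinant bounds that follow; no diagonalisation takes place.\<close>

lemma gram_det_eigenvalues: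
  fixes C :: "real mat"
  assumes C: "C \<in> carrier_mat n m"
  obtains es where "length es = m"
    "\<And>e. e \<in> set es \<Longrightarrow> eigenvalue (transpose_mat C * C) e \<and> e \<ge> 0"
    "\<And>x. det (x \<cdot>\<^sub>m 1\<^sub>m m + transpose_mat C * C) = (\<Prod>e\<leftarrow>es. x + e)"
proof -
  let ?K = "transpose_mat C * C"
  have K: "?K \<in> carrier_mat m m" using C by simp
  let ?L = "map_mat complex_of_real ?K"
  have L: "?L \<in> carrier_mat m m" using K by simp
  from char_poly_factorized[OF L] obtain as
    where as: "char_poly ?L = (\<Prod>a\<leftarrow>as. [:- a, 1:])" "length as = m" by auto
  have cp: "char_poly ?L = map_poly complex_of_real (char_poly ?K)"
    by (rule of_real_hom.char_poly_hom[OF K])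
  have root: "eigenvalue ?L a" if "a \<in> set as" for a
    unfolding eigenvalue_root_char_poly[OF L] as(1) poly_prod_list
    using that by (auto simp: prod_list_zero_iff o_def image_iff intro!: bexI[of _ a])
  define es where "es = map Re as"
  have re: "a = complex_of_real (Re a) \<and> Re a \<ge> 0" if "a \<in> set as" for a
    using gram_eigenvalue_nonneg[OF C root[OF that]] by auto
  have polyK: "poly (char_poly ?K) x = (\<Prod>e\<leftarrow>es. x - e)" for x
  proof -
    have "complex_of_real (poly (char_poly ?K) x) = poly (char_poly ?L) (complex_of_real x)"
      unfolding cp by simp
    also have "\<dots> = (\<Prod>a\<leftarrow>as. complex_of_real x - a)"
      unfolding as(1) poly_prod_list by (simp add: o_def)
    also have "\<dots> = (\<Prod>a\<leftarrow>as. complex_of_real (x - Re a))"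
      using re by (intro arg_cong[where f = prod_list] map_cong) (auto simp: complex_eq_iff)
    also have "\<dots> = complex_of_real (\<Prod>e\<leftarrow>es. x - e)"
      unfolding es_def by (induction as) auto
    finally show ?thesis by (simp only: of_real_eq_iff)
  qed
  have det: "det (x \<cdot>\<^sub>m 1\<^sub>m m + ?K) = (\<Prod>e\<leftarrow>es. x + e)" for x
  proof -
    \<comment> \<open>The determinant is, up to sign, the characteristic polynomial at
      \<open>-x\<close>; the sign \<open>(-1)^m\<close> occurs on both sides and cancels.\<close>
    have "- (char_matrix ?K (-x)) = (-1) \<cdot>\<^sub>m (x \<cdot>\<^sub>m 1\<^sub>m m + ?K)"
      unfolding char_matrix_def using C by (intro eq_matI) auto
    then have "poly (char_poly ?K) (-x) = (-1)^m * det (x \<cdot>\<^sub>m 1\<^sub>m m + ?K)"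
      unfolding char_poly_matrix[OF K] using C by simp
    moreover have "(\<Prod>e\<leftarrow>es. -x - e) = (-1)^length es * (\<Prod>e\<leftarrow>es. x + e)"
      by (induction es) (auto simp: algebra_simps)
    ultimately show ?thesis unfolding polyK using as(2) by (simp add: es_def)
  qed
  show thesis
  proof (rule that[of es])
    show "length es = m" using as(2) by (simp add: es_def)
    show "eigenvalue ?K e \<and> e \<ge> 0" if "e \<in> set es" for e
    proof
      show "eigenvalue ?K e" unfolding eigenvalue_root_char_poly[OF K] polyK
        using that by (auto simp: prod_list_zero_iff image_iff intro!: bexI[of _ e])
      show "e \<ge> 0" using that re unfolding es_def by auto
    qed
  qed (rule det)
qed

lemma prod_list_mono_real:
  fixes f g :: "'b \<Rightarrow> real"
  assumes "\<And>x. x \<in> set xs \<Longrightarrow> 0 \<le> f x \<and> f x \<le> g x"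
  shows "0 \<le> (\<Prod>x\<leftarrow>xs. f x) \<and> (\<Prod>x\<leftarrow>xs. f x) \<le> (\<Prod>x\<leftarrow>xs. g x)"
  using assms
proof (induction xs)
  case (Cons a xs)
  then have "0 \<le> (\<Prod>x\<leftarrow>xs. f x) \<and> (\<Prod>x\<leftarrow>xs. f x) \<le> (\<Prod>x\<leftarrow>xs. g x)" "0 \<le> f a \<and> f a \<le> g a"
    by auto
  then show ?case by (auto intro!: mult_mono mult_nonneg_nonneg)
qed simp

text \<open>The eigenvalue factorisation at \<open>x = 0\<close> and at \<open>x = 1\<close> is
  compared factor by factor.\<close>

lemma det_gram_le_det_one_plus_gram:
  fixes C :: "real mat"
  assumes C: "C \<in> carrier_mat n m"
  shows "det (transpose_mat C * C) \<le> det (1\<^sub>m m + transpose_mat C * C)"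
proof -
  obtain es where es: "\<And>e. e \<in> set es \<Longrightarrow> eigenvalue (transpose_mat C * C) e \<and> e \<ge> 0"
    "\<And>x. det (x \<cdot>\<^sub>m 1\<^sub>m m + transpose_mat C * C) = (\<Prod>e\<leftarrow>es. x + e)"
    using gram_det_eigenvalues[OF C] by metis
  have "0 \<cdot>\<^sub>m 1\<^sub>m m + transpose_mat C * C = transpose_mat C * C"
    "1 \<cdot>\<^sub>m 1\<^sub>m m + transpose_mat C * C = 1\<^sub>m m + transpose_mat C * C"
    using C by (auto intro!: eq_matI)
  then show ?thesis
    using es(2)[of 0] es(2)[of 1] prod_list_mono_real[of es "\<lambda>e. e" "\<lambda>e. 1 + e"] es(1) by simp
qed

text \<open>Every factor of the determinant is an eigenvalue, hence at least
  \<open>lambda_min\<close>. For \<open>m = 0\<close> both sides are 1, whatever \<open>Min\<close>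
  returns for the empty set of eigenvalues.\<close>

lemma lambda_min_power_le_det_gram:
  fixes C :: "real mat"
  assumes C: "C \<in> carrier_mat n m" and l: "l \<ge> 0"
    and min: "l \<le> lambda_min (transpose_mat C * C)"
  shows "l ^ m \<le> det (transpose_mat C * C)"
proof -
  let ?K = "transpose_mat C * C"
  have K: "?K \<in> carrier_mat m m" using C by simp
  obtain es where es: "length es = m" "\<And>e. e \<in> set es \<Longrightarrow> eigenvalue ?K e \<and> e \<ge> 0"
    "\<And>x. det (x \<cdot>\<^sub>m 1\<^sub>m m + ?K) = (\<Prod>e\<leftarrow>es. x + e)"
    using gram_det_eigenvalues[OF C] by metis
  have ne: "char_poly ?K \<noteq> 0" using degree_monic_char_poly[OF K] by (metis coeff_0 zero_neq_one)
  have fin: "finite {k. eigenvalue ?K k}"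
    unfolding eigenvalue_root_char_poly[OF K] using ne by (rule poly_roots_finite)
  have "l \<le> e" if "e \<in> set es" for e
    using min es(2)[OF that] Min_le[OF fin, of e] unfolding lambda_min_def by simp
  then have "(\<Prod>e\<leftarrow>es. l) \<le> (\<Prod>e\<leftarrow>es. e)"
    using prod_list_mono_real[of es "\<lambda>_. l" "\<lambda>e. e"] l by simp
  moreover have "0 \<cdot>\<^sub>m 1\<^sub>m m + ?K = ?K" using C by (auto intro!: eq_matI)
  ultimately show ?thesis using es(3)[of 0] es(1) by (simp add: map_replicate_const)
qed

text \<open>\<open>mat_inv\<close> selects from an option; a nonzero determinant excludes
  \<open>None\<close>.\<close>

lemma mat_inv_inverts:
  assumes A: "A \<in> carrier_mat m m" and "det A \<noteq> 0"
  shows "A * mat_inv A = 1\<^sub>m m" "mat_inv A * A = 1\<^sub>m m" "mat_inv A \<in> carrier_mat m m"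
proof -
  have "A \<in> Units (ring_mat TYPE(real) m undefined)"
    using assms by (simp add: det_non_zero_imp_unit)
  then obtain B where "mat_inverse A = Some B" using mat_inverse(1)[OF A, of undefined] by fastforce
  then show "A * mat_inv A = 1\<^sub>m m" "mat_inv A * A = 1\<^sub>m m" "mat_inv A \<in> carrier_mat m m"
    using mat_inverse(2)[OF A] unfolding mat_inv_def by auto
qed

section \<open>Column submatrices and least squares\<close>

context
  fixes X :: "real mat" and n p :: nat and g :: "nat set"
  assumes X: "X \<in> carrier_mat n p" and g: "g \<subseteq> {..<p}"
begin

lemma finite_model: "finite g" using g finite_subset by blast

text \<open>Columns of \<open>Xsub X g\<close> are numbered by position, whereas the Gaussian
  integrals run over functions on \<open>g\<close> itself. Sums are carried from one indexing to the
  other along this bijection.\<close>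

lemma bij_betw_pick: "bij_betw (pick g) {..<card g} g"
proof -
  have "inj_on (pick g) {..<card g}"
    by (rule inj_onI) (metis lessThan_iff nat_neq_iff pick_mono less_irrefl)
  moreover have "pick g ` {..<card g} \<subseteq> g" using pick_in_set by auto
  ultimately show ?thesis
    unfolding bij_betw_def using card_subset_eq[OF finite_model] by (simp add: card_image)
qed

lemma Xsub_carrier: "Xsub X g \<in> carrier_mat n (card g)"
proof -
  have "{i. i < n \<and> i < n} = {..<n}" "{j. j < p \<and> j \<in> g} = g" using g by auto
  then show ?thesis using X unfolding Xsub_def by (intro carrier_matI) (simp_all add: dim_submatrix)
qed

lemma Xsub_index:
  assumes "i < n" "k < card g"
  shows "Xsub X g $$ (i, k) = X $$ (i, pick g k)"
proof -
  have *: "{i. i < n \<and> i < n} = {..<n}" "{j. j < p \<and> j \<in> g} = g" using g by auto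
  have "{a \<in> {..<n}. a < i} = {..<i}" using assms by auto
  then have "pick {..<n} i = i" using pick_card_in_set[of i "{..<n}"] assms by simp
  then show ?thesis using X assms * unfolding Xsub_def by (simp add: submatrix_index)
qed

lemma Xsub_mult_vec_index:
  assumes "i < n" "u \<in> carrier_vec (card g)" "\<And>k. k < card g \<Longrightarrow> u $ k = b (pick g k)"
  shows "(Xsub X g *\<^sub>v u) $ i = (\<Sum>j\<in>g. X $$ (i, j) * b j)"
proof -
  have "(Xsub X g *\<^sub>v u) $ i = (\<Sum>k\<in>{..<card g}. X $$ (i, pick g k) * b (pick g k))"
    using assms Xsub_carrier by (auto simp: scalar_prod_def Xsub_index atLeast0LessThan intro!: sum.cong)
  also have "\<dots> = (\<Sum>j\<in>g. X $$ (i, j) * b j)"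
    by (rule sum.reindex_bij_betw[OF bij_betw_pick])
  finally show ?thesis .
qed

text \<open>With \<open>A = Xsub X g\<close>, the solution of \<open>A^T A u = A^T y\<close> leaves
  a residual orthogonal to every fit. Explicit sums over \<open>g\<close> are the form in which the
  orthogonality meets the integrals over coefficients.\<close>

lemma normal_equations:
  assumes det: "det (transpose_mat (Xsub X g) * Xsub X g) \<noteq> 0" and y: "y \<in> carrier_vec n"
  shows "\<exists>b0. \<forall>b. (\<Sum>i<n. (\<Sum>j\<in>g. X $$ (i, j) * b j) * (y $ i - (\<Sum>j\<in>g. X $$ (i, j) * b0 j))) = 0"
proof -
  define A where "A = Xsub X g"
  have A: "A \<in> carrier_mat n (card g)" unfolding A_def by (rule Xsub_carrier)
  define B where "B = transpose_mat A * A"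
  have B: "B \<in> carrier_mat (card g) (card g)" unfolding B_def using A by simp
  note inv = mat_inv_inverts[OF B det[folded A_def, folded B_def]]
  define u where "u = mat_inv B *\<^sub>v (transpose_mat A *\<^sub>v y)"
  have u: "u \<in> carrier_vec (card g)" unfolding u_def using inv A y by simp
  have Bu: "B *\<^sub>v u = transpose_mat A *\<^sub>v y"
    unfolding u_def using inv A y B
    by (subst assoc_mult_mat_vec[symmetric, of _ "card g" "card g" _ "card g"]) auto
  have Au: "transpose_mat A *\<^sub>v (A *\<^sub>v u) = transpose_mat A *\<^sub>v y"
    unfolding Bu[symmetric] B_def using A u
    by (subst assoc_mult_mat_vec[of _ "card g" n _ "card g"]) auto
  define b0 where "b0 = (\<lambda>j. u $ (the_inv_into {..<card g} (pick g) j))"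
  have b0: "u $ k = b0 (pick g k)" if "k < card g" for k
    unfolding b0_def using that bij_betw_pick
    by (simp add: the_inv_into_f_f bij_betw_def)
  have "(\<Sum>i<n. (\<Sum>j\<in>g. X $$ (i, j) * b j) * (y $ i - (\<Sum>j\<in>g. X $$ (i, j) * b0 j))) = 0" for b
  proof -
    define v where "v = vec (card g) (\<lambda>k. b (pick g k))"
    have v: "v \<in> carrier_vec (card g)" unfolding v_def by simp
    have "(\<Sum>i<n. (\<Sum>j\<in>g. X $$ (i, j) * b j) * (y $ i - (\<Sum>j\<in>g. X $$ (i, j) * b0 j)))
        = (\<Sum>i<n. (A *\<^sub>v v) $ i * (y $ i - (A *\<^sub>v u) $ i))"
      unfolding A_def
      by (intro sum.cong refl arg_cong2[where f = "(*)"] arg_cong2[where f = "(-)"] 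
          Xsub_mult_vec_index[symmetric] u b0) (auto simp: v_def)
    also have "\<dots> = (\<Sum>i<n. y $ i * (A *\<^sub>v v) $ i) - (\<Sum>i<n. (A *\<^sub>v u) $ i * (A *\<^sub>v v) $ i)"
      by (simp add: algebra_simps sum_subtractf)
    also have "\<dots> = y \<bullet> (A *\<^sub>v v) - (A *\<^sub>v u) \<bullet> (A *\<^sub>v v)"
      using A by (auto simp: scalar_prod_def atLeast0LessThan)
    also have "y \<bullet> (A *\<^sub>v v) = (transpose_mat A *\<^sub>v y) \<bullet> v"
      by (rule transpose_vec_mult_scalar[OF A v y, symmetric])
    also have "(A *\<^sub>v u) \<bullet> (A *\<^sub>v v) = (transpose_mat A *\<^sub>v (A *\<^sub>v u)) \<bullet> v"
      by (rule transpose_vec_mult_scalar[symmetric, OF A v]) (use A u in simp)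
    finally show ?thesis unfolding Au by simp
  qed
  then show ?thesis by blast
qed

text \<open>The matrix \<open>(A^T A)^-1 A^T\<close> is a left inverse of
  \<open>A = Xsub X g\<close>, so Cauchy-Schwarz applies with its squared Frobenius norm as
  constant. This coercivity later makes the Gaussian integral over the coefficients finite.\<close>

lemma coefficients_bounded_by_fit:
  assumes det: "det (transpose_mat (Xsub X g) * Xsub X g) \<noteq> 0"
  shows "\<exists>L>0. \<forall>b. (\<Sum>j\<in>g. (b j)\<^sup>2) \<le> L * (\<Sum>i<n. (\<Sum>j\<in>g. X $$ (i, j) * b j)\<^sup>2)"
proof -
  define A where "A = Xsub X g"
  have A: "A \<in> carrier_mat n (card g)" unfolding A_def by (rule Xsub_carrier)
  define B where "B = transpose_mat A * A"
  have B: "B \<in> carrier_mat (card g) (card g)" unfolding B_def using A by simp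
  note inv = mat_inv_inverts[OF B det[folded A_def, folded B_def]]
  define N where "N = mat_inv B * transpose_mat A"
  have N: "N \<in> carrier_mat (card g) n" unfolding N_def using inv A by simp
  have NA: "N * A = 1\<^sub>m (card g)"
    unfolding N_def using inv A B_def by (subst assoc_mult_mat[of _ "card g" "card g" _ n]) auto
  define L where "L = (\<Sum>k<card g. \<Sum>i<n. (N $$ (k,i))\<^sup>2)"
  have L0: "L \<ge> 0" unfolding L_def by (intro sum_nonneg) auto
  have "(\<Sum>j\<in>g. (b j)\<^sup>2) \<le> L * (\<Sum>i<n. (\<Sum>j\<in>g. X $$ (i, j) * b j)\<^sup>2)" for b
  proof -
    define v where "v = vec (card g) (\<lambda>k. b (pick g k))"
    have v: "v \<in> carrier_vec (card g)" unfolding v_def by simp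
    have Nv: "N *\<^sub>v (A *\<^sub>v v) = v"
      using assoc_mult_mat_vec[OF N A v] NA v by simp
    have bk: "(b (pick g k))\<^sup>2 \<le> (\<Sum>i<n. (N $$ (k,i))\<^sup>2) * (\<Sum>i<n. ((A *\<^sub>v v) $ i)\<^sup>2)" if k: "k < card g" for k
    proof -
      have "b (pick g k) = (N *\<^sub>v (A *\<^sub>v v)) $ k" unfolding Nv using k by (simp add: v_def)
      also have "\<dots> = (\<Sum>i<n. N $$ (k,i) * (A *\<^sub>v v) $ i)"
        using k N A by (auto simp: scalar_prod_def atLeast0LessThan)
      finally show ?thesis using Cauchy_Schwarz_ineq_sum by metis
    qed
    have "(\<Sum>j\<in>g. (b j)\<^sup>2) = (\<Sum>k<card g. (b (pick g k))\<^sup>2)"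
      by (rule sum.reindex_bij_betw[OF bij_betw_pick, symmetric])
    also have "\<dots> \<le> (\<Sum>k<card g. (\<Sum>i<n. (N $$ (k,i))\<^sup>2) * (\<Sum>i<n. ((A *\<^sub>v v) $ i)\<^sup>2))"
      using bk by (intro sum_mono) auto
    also have "\<dots> = L * (\<Sum>i<n. ((A *\<^sub>v v) $ i)\<^sup>2)"
      unfolding L_def by (simp add: sum_distrib_right)
    also have "(\<Sum>i<n. ((A *\<^sub>v v) $ i)\<^sup>2) = (\<Sum>i<n. (\<Sum>j\<in>g. X $$ (i, j) * b j)\<^sup>2)"
      unfolding A_def
      by (intro sum.cong refl arg_cong2[where f = power] Xsub_mult_vec_index) (auto simp: v_def)
    finally show ?thesis .
  qed
  \<comment> \<open>Adding 1 makes the constant strictly positive even when \<open>g\<close> is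
    empty.\<close>
  then have "(\<Sum>j\<in>g. (b j)\<^sup>2) \<le> (L + 1) * (\<Sum>i<n. (\<Sum>j\<in>g. X $$ (i, j) * b j)\<^sup>2)" for b
    by (rule order_trans) (auto intro!: mult_right_mono sum_nonneg)
  with L0 show ?thesis by (intro exI[of _ "L + 1"]) auto
qed

section \<open>Determinant and quadratic form under the prior scales\<close>

context
  fixes c :: "nat \<Rightarrow> real" and f :: real
  assumes f: "f > 0" and c: "\<And>j. j \<in> g \<Longrightarrow> f \<le> c j"
begin

lemma prior_scale_pick: assumes "k < card g" shows "f \<le> c (pick g k)" "c (pick g k) > 0"
  using c[OF pick_in_set_le[OF assms]] f by auto

lemma Sigma_sub_carrier: "Sigma_sub c g \<in> carrier_mat (card g) (card g)"
  and Sigma_sqrt_sub_carrier: "Sigma_sqrt_sub c g \<in> carrier_mat (card g) (card g)"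
  unfolding Sigma_sub_def Sigma_sqrt_sub_def by auto

lemma Sigma_sqrt_sub_squared: "Sigma_sqrt_sub c g * Sigma_sqrt_sub c g = Sigma_sub c g"
  using prior_scale_pick(2)[THEN less_imp_le] unfolding Sigma_sub_def Sigma_sqrt_sub_def
  by (intro eq_matI) (auto simp: scalar_prod_def sum.delta if_distrib[where f = "\<lambda>x. x * _"] cong: if_cong)

lemma det_Sigma_sub: "det (Sigma_sub c g) \<ge> f ^ card g"
proof -
  have "det (Sigma_sub c g) = prod_list (diag_mat (Sigma_sub c g))"
    by (rule det_upper_triangular[OF _ Sigma_sub_carrier]) (auto simp: Sigma_sub_def upper_triangular_def)
  also have "diag_mat (Sigma_sub c g) = map (\<lambda>i. c (pick g i)) [0..<card g]"
    by (auto simp: diag_mat_def Sigma_sub_def)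
  finally show ?thesis
    using prod_list_mono_real[of "[0..<card g]" "\<lambda>_. f" "\<lambda>i. c (pick g i)"] prior_scale_pick f
    by (auto simp: map_replicate_const)
qed

lemma mat_inv_Sigma_sub:
  "mat_inv (Sigma_sub c g) = mat (card g) (card g) (\<lambda>(i,k). if i = k then 1 / c (pick g i) else 0)"
    (is "_ = ?D")
proof -
  have D: "?D \<in> carrier_mat (card g) (card g)" by simp
  have "det (Sigma_sub c g) \<noteq> 0" using det_Sigma_sub f by (smt (verit) zero_less_power)
  note inv = mat_inv_inverts[OF Sigma_sub_carrier this]
  have "Sigma_sub c g * ?D = 1\<^sub>m (card g)"
    using prior_scale_pick unfolding Sigma_sub_def 
    by (intro eq_matI) (force simp: scalar_prod_def sum.delta if_distrib[where f = "\<lambda>x. x * _"] cong: if_cong)+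
  then have "mat_inv (Sigma_sub c g) * (Sigma_sub c g * ?D) = mat_inv (Sigma_sub c g)"
    using inv by simp
  then show ?thesis
    using assoc_mult_mat[OF inv(3) Sigma_sub_carrier D] inv(2) D by simp
qed

lemma U_mat_carrier: "U_mat X c g \<in> carrier_mat (card g) (card g)"
  unfolding U_mat_def mat_inv_Sigma_sub using Xsub_carrier by simp

text \<open>With \<open>S\<close> the square root of the prior scale matrix and
  \<open>A = Xsub X g\<close>, \<open>U_mat\<close> is \<open>S^-2 + A^T A\<close>. Multiplying by
  \<open>S\<close> on both sides turns the first term into the identity and the second into the Gram
  matrix of \<open>A * S\<close>.\<close>

lemma W_mat_eq:
  "W_mat X c g = 1\<^sub>m (card g) + transpose_mat (Xsub X g * Sigma_sqrt_sub c g) * (Xsub X g * Sigma_sqrt_sub c g)"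
proof -
  define S where "S = Sigma_sqrt_sub c g"
  define A where "A = Xsub X g"
  have S: "S \<in> carrier_mat (card g) (card g)" unfolding S_def by (rule Sigma_sqrt_sub_carrier)
  have A: "A \<in> carrier_mat n (card g)" unfolding A_def by (rule Xsub_carrier)
  define D where "D = mat_inv (Sigma_sub c g)"
  have D: "D \<in> carrier_mat (card g) (card g)" unfolding D_def mat_inv_Sigma_sub by simp
  have SDS: "S * D * S = 1\<^sub>m (card g)"
  proof -
    have sc: "sqrt (c (pick g k)) / c (pick g k) = 1 / sqrt (c (pick g k))" if "k < card g" for k
      using real_div_sqrt[of "c (pick g k)"] prior_scale_pick(2)[OF that] by (simp add: field_simps)
    have "S * D = mat (card g) (card g) (\<lambda>(i,k). if i = k then 1 / sqrt (c (pick g i)) else 0)"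
      using sc unfolding S_def D_def mat_inv_Sigma_sub Sigma_sqrt_sub_def
      by (intro eq_matI) (auto simp: scalar_prod_def sum.delta if_distrib[where f = "\<lambda>x. x * _"] cong: if_cong)
    also have "\<dots> * S = 1\<^sub>m (card g)"
      using prior_scale_pick unfolding S_def Sigma_sqrt_sub_def
      by (intro eq_matI) (force simp: scalar_prod_def sum.delta if_distrib[where f = "\<lambda>x. x * _"] cong: if_cong)+
    finally show ?thesis .
  qed
  have ST: "transpose_mat S = S" unfolding S_def Sigma_sqrt_sub_def by (intro eq_matI) auto
  have "W_mat X c g = S * (D + transpose_mat A * A) * S"
    unfolding W_mat_def U_mat_def S_def D_def A_def ..
  also have "\<dots> = S * D * S + S * (transpose_mat A * A) * S"
    using S D A by (simp add: mult_add_distrib_mat[of _ "card g" "card g" _ "card g"] add_mult_distrib_mat[of _ "card g" "card g" _ _ "card g"])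
  also have "S * (transpose_mat A * A) * S = transpose_mat (A * S) * (A * S)"
    using S A by (simp add: transpose_mult[of _ n "card g" _ "card g"] ST
        assoc_mult_mat[of _ "card g" "card g" _ n _ "card g"] assoc_mult_mat[of _ "card g" "card g" _ "card g" _ "card g"]
        assoc_mult_mat[of _ "card g" n _ "card g" _ "card g"])
  finally show ?thesis unfolding SDS unfolding S_def A_def .
qed

text \<open>Dropping the identity from \<open>W_mat\<close> can only lower the determinant, and the
  remaining Gram determinant of \<open>A * S\<close> factors as that of \<open>Sigma_sub\<close>
  times that of \<open>A^T A\<close>.\<close>

lemma det_W_mat_ge:
  assumes "det (transpose_mat (Xsub X g) * Xsub X g) \<ge> 0"
  shows "f ^ card g * det (transpose_mat (Xsub X g) * Xsub X g) \<le> det (W_mat X c g)"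
proof -
  define S where "S = Sigma_sqrt_sub c g"
  define A where "A = Xsub X g"
  have S: "S \<in> carrier_mat (card g) (card g)" unfolding S_def by (rule Sigma_sqrt_sub_carrier)
  have A: "A \<in> carrier_mat n (card g)" unfolding A_def by (rule Xsub_carrier)
  have AA: "transpose_mat A * A \<in> carrier_mat (card g) (card g)" using A by simp
  have ST: "transpose_mat S = S" unfolding S_def Sigma_sqrt_sub_def by (intro eq_matI) auto
  have "transpose_mat (A * S) * (A * S) = S * (transpose_mat A * A) * S"
    using S A by (simp add: transpose_mult[of _ n "card g" _ "card g"] ST
        assoc_mult_mat[of _ "card g" "card g" _ n _ "card g"] assoc_mult_mat[of _ "card g" "card g" _ "card g" _ "card g"]
        assoc_mult_mat[of _ "card g" n _ "card g" _ "card g"])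
  then have "det (transpose_mat (A * S) * (A * S)) = det S * det (transpose_mat A * A) * det S"
    using S AA by (simp add: det_mult[of _ "card g"])
  also have "\<dots> = det (S * S) * det (transpose_mat A * A)" using S by (simp add: det_mult[of _ "card g"])
  also have "S * S = Sigma_sub c g" unfolding S_def by (rule Sigma_sqrt_sub_squared)
  also have "det (Sigma_sub c g) * det (transpose_mat A * A) \<ge> f ^ card g * det (transpose_mat A * A)"
    using det_Sigma_sub assms unfolding A_def by (rule mult_right_mono)
  finally show ?thesis
    using det_gram_le_det_one_plus_gram[of "A * S" n "card g"] A S
    unfolding W_mat_eq S_def A_def by simp
qed

text \<open>The witness is the ridge estimate \<open>w = U^-1 A^T y\<close>. The quadratic form
  equals |y|^2 - y.Aw, while the residual of the fit \<open>A w\<close> is |y|^2 - 2 y.Aw + |Aw|^2,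
  so the claim reduces to y.Aw \<ge> |Aw|^2.\<close>

lemma quadratic_form_ge_residual:
  assumes det: "det (transpose_mat (Xsub X g) * Xsub X g) > 0" and y: "y \<in> carrier_vec n"
  shows "\<exists>b. (\<Sum>i<n. (y $ i - (\<Sum>j\<in>g. X $$ (i, j) * b j))\<^sup>2)
    \<le> y \<bullet> ((1\<^sub>m n - Xsub X g * mat_inv (U_mat X c g) * transpose_mat (Xsub X g)) *\<^sub>v y)"
proof -
  define S where "S = Sigma_sqrt_sub c g"
  define A where "A = Xsub X g"
  define U where "U = U_mat X c g"
  define D where "D = mat_inv (Sigma_sub c g)"
  have S: "S \<in> carrier_mat (card g) (card g)" unfolding S_def by (rule Sigma_sqrt_sub_carrier)
  have A: "A \<in> carrier_mat n (card g)" unfolding A_def by (rule Xsub_carrier)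
  have U: "U \<in> carrier_mat (card g) (card g)" unfolding U_def by (rule U_mat_carrier)
  have D: "D \<in> carrier_mat (card g) (card g)" unfolding D_def mat_inv_Sigma_sub by simp
  have "0 < f ^ card g * det (transpose_mat (Xsub X g) * Xsub X g)" using det f by simp
  \<comment> \<open>Invertibility of \<open>U\<close> is read off from the positive determinant of
    \<open>W = S U S\<close>.\<close>
  then have "det (S * U * S) > 0" using det_W_mat_ge det unfolding W_mat_def S_def U_def by linarith
  then have "det U \<noteq> 0" using S U by (auto simp: det_mult[of _ "card g"])
  note inv = mat_inv_inverts[OF U this]
  define w where "w = mat_inv U *\<^sub>v (transpose_mat A *\<^sub>v y)"
  have w: "w \<in> carrier_vec (card g)" unfolding w_def using inv A y by simp
  have Uw: "U *\<^sub>v w = transpose_mat A *\<^sub>v y"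
    unfolding w_def using inv A y U
    by (subst assoc_mult_mat_vec[symmetric, of _ "card g" "card g" _ "card g"]) auto
  define b where "b = (\<lambda>j. w $ (the_inv_into {..<card g} (pick g) j))"
  have b: "w $ k = b (pick g k)" if "k < card g" for k
    unfolding b_def using that bij_betw_pick
    by (simp add: the_inv_into_f_f bij_betw_def)
  have Aw: "A *\<^sub>v w \<in> carrier_vec n" using A w by simp
  have "(1\<^sub>m n - A * mat_inv U * transpose_mat A) *\<^sub>v y = y - A *\<^sub>v w"
    unfolding w_def using A inv y
    by (simp add: minus_mult_distrib_mat_vec[of _ n n] assoc_mult_mat_vec[of _ n "card g" _ n]
      assoc_mult_mat_vec[of _ n "card g" _ "card g"])
  then have "y \<bullet> ((1\<^sub>m n - A * mat_inv U * transpose_mat A) *\<^sub>v y) = y \<bullet> y - y \<bullet> (A *\<^sub>v w)"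
    using y Aw by (simp add: scalar_prod_minus_distrib)
  \<comment> \<open>Since \<open>U w = A^T y\<close>, the left side is w.Uw, and \<open>U\<close>
    exceeds \<open>A^T A\<close> by a diagonal matrix with positive entries.\<close>
  moreover have "y \<bullet> (A *\<^sub>v w) \<ge> (A *\<^sub>v w) \<bullet> (A *\<^sub>v w)"
  proof -
    have "y \<bullet> (A *\<^sub>v w) = (U *\<^sub>v w) \<bullet> w"
      unfolding Uw by (rule transpose_vec_mult_scalar[OF A w y, symmetric])
    also have "U *\<^sub>v w = D *\<^sub>v w + transpose_mat A *\<^sub>v (A *\<^sub>v w)"
      unfolding U_def U_mat_def A_def[symmetric] D_def[symmetric]
      using D A w by (simp add: add_mult_distrib_mat_vec[of _ "card g" "card g"] assoc_mult_mat_vec[of _ "card g" n _ "card g"])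
    also have "\<dots> \<bullet> w = (D *\<^sub>v w) \<bullet> w + (transpose_mat A *\<^sub>v (A *\<^sub>v w)) \<bullet> w"
      using D A w by (intro add_scalar_prod_distrib[of _ "card g"]) auto
    also have "(transpose_mat A *\<^sub>v (A *\<^sub>v w)) \<bullet> w = (A *\<^sub>v w) \<bullet> (A *\<^sub>v w)"
      by (rule transpose_vec_mult_scalar[OF A w Aw])
    also have "(D *\<^sub>v w) \<bullet> w = (\<Sum>k<card g. (1 / c (pick g k)) * (w $ k * w $ k))"
      unfolding D_def mat_inv_Sigma_sub using w
      by (auto simp: scalar_prod_def atLeast0LessThan sum.delta if_distrib[where f = "\<lambda>x. x * _"] intro!: sum.cong cong: if_cong)
    also have "\<dots> + (A *\<^sub>v w) \<bullet> (A *\<^sub>v w) \<ge> 0 + (A *\<^sub>v w) \<bullet> (A *\<^sub>v w)"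
      using prior_scale_pick(2)[THEN less_imp_le]
      by (intro add_right_mono sum_nonneg mult_nonneg_nonneg[OF _ zero_le_square]) auto
    finally show ?thesis by simp
  qed
  moreover have "(\<Sum>i<n. (y $ i - (\<Sum>j\<in>g. X $$ (i, j) * b j))\<^sup>2) = (\<Sum>i<n. (y $ i - (A *\<^sub>v w) $ i)\<^sup>2)"
    unfolding A_def
    by (intro sum.cong refl arg_cong2[where f = power] arg_cong2[where f = "(-)"] 
          Xsub_mult_vec_index[symmetric] w b) auto
  moreover have "(\<Sum>i<n. (y $ i - z $ i)\<^sup>2) = y \<bullet> y - 2 * (y \<bullet> z) + z \<bullet> z"
    if "z \<in> carrier_vec n" for z
    using y that by (auto simp: scalar_prod_def atLeast0LessThan power2_diff power2_eq_square
      sum.distrib sum_subtractf sum_distrib_left algebra_simps)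
  note this[OF Aw]
  ultimately show ?thesis unfolding A_def U_def by (intro exI[of _ b]) linarith
qed

end
end

subsection \<open>Gaussian integrals\<close>

text \<open>Induction on the coordinates: substitute in the new one, then apply the hypothesis to
  the function with that coordinate integrated out. Two cases matter later, the pure shift
  \<open>c = 1\<close> and the pure scaling \<open>t = 0\<close>.\<close>

lemma nn_integral_PiM_lborel_affine:
  fixes f :: "('i \<Rightarrow> real) \<Rightarrow> ennreal"
  assumes I: "finite I" and c: "c \<noteq> 0"
    and f: "f \<in> borel_measurable (PiM I (\<lambda>_. lborel))"
  shows "(\<integral>\<^sup>+ b. f b \<partial>PiM I (\<lambda>_. lborel))
    = ennreal (\<bar>c\<bar> ^ card I) * (\<integral>\<^sup>+ b. f (\<lambda>i\<in>I. t i + c * b i) \<partial>PiM I (\<lambda>_. lborel))"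
  using I f
proof (induction I arbitrary: f rule: finite_induct)
  case empty
  show ?case by (simp add: PiM_empty restrict_def nn_integral_count_space_finite)
next
  case (insert i I)
  interpret product_sigma_finite "\<lambda>_. lborel :: real measure" by standard
  interpret I: finite_product_sigma_finite "\<lambda>_. lborel :: real measure" I by standard (rule insert)
  note [measurable] = insert.prems
  have upd: "(\<lambda>z. (fst z)(i := snd z)) \<in> measurable (PiM I (\<lambda>_. lborel) \<Otimes>\<^sub>M lborel) (PiM (insert i I) (\<lambda>_. lborel :: real measure))"
    using measurable_add_dim[of i I "\<lambda>_. lborel :: real measure"] by (simp add: case_prod_beta')
  have upd': "(\<lambda>z. (fst z)(i := t i + c * snd z)) \<in> measurable (PiM I (\<lambda>_. lborel) \<Otimes>\<^sub>M lborel) (PiM (insert i I) (\<lambda>_. lborel :: real measure))"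
  proof -
    have "(\<lambda>z. (fst z, t i + c * snd z)) \<in> measurable (PiM I (\<lambda>_. lborel) \<Otimes>\<^sub>M lborel) (PiM I (\<lambda>_. lborel) \<Otimes>\<^sub>M (lborel :: real measure))"
      by measurable
    from measurable_compose[OF this upd] show ?thesis by simp
  qed
  have m1: "(\<lambda>z. f ((fst z)(i := t i + c * snd z))) \<in> borel_measurable (PiM I (\<lambda>_. lborel) \<Otimes>\<^sub>M lborel)"
    by (rule measurable_compose[OF upd' insert.prems])
  have m2: "(\<lambda>x. \<integral>\<^sup>+ y. f (x(i := t i + c * y)) \<partial>lborel) \<in> borel_measurable (PiM I (\<lambda>_. lborel))"
    using m1 by (intro lborel.borel_measurable_nn_integral) (simp add: case_prod_beta')
  have m3: "(\<lambda>y. f (x(i := y))) \<in> borel_measurable borel" if "x \<in> space (PiM I (\<lambda>_. lborel))" for x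
  proof -
    have "(\<lambda>y. (x, y)) \<in> measurable borel (PiM I (\<lambda>_. lborel) \<Otimes>\<^sub>M (lborel :: real measure))" using that by measurable
    from measurable_compose[OF measurable_compose[OF this upd] insert.prems] show ?thesis
      by (simp add: fun_upd_def)
  qed
  have aff: "(\<lambda>z. \<lambda>j\<in>insert i I. t j + c * z j) \<in> measurable (PiM (insert i I) (\<lambda>_. lborel)) (PiM (insert i I) (\<lambda>_. lborel :: real measure))"
    by measurable
  have "(\<integral>\<^sup>+ b. f b \<partial>PiM (insert i I) (\<lambda>_. lborel))
      = (\<integral>\<^sup>+ x. \<integral>\<^sup>+ y. f (x(i := y)) \<partial>lborel \<partial>PiM I (\<lambda>_. lborel))"
    by (rule product_nn_integral_insert) (use insert in auto)
  also have "\<dots> = (\<integral>\<^sup>+ x. ennreal \<bar>c\<bar> * (\<integral>\<^sup>+ y. f (x(i := t i + c * y)) \<partial>lborel) \<partial>PiM I (\<lambda>_. lborel))"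
    by (intro nn_integral_cong nn_integral_real_affine m3 c)
  also have "\<dots> = ennreal \<bar>c\<bar> * (\<integral>\<^sup>+ x. (\<integral>\<^sup>+ y. f (x(i := t i + c * y)) \<partial>lborel) \<partial>PiM I (\<lambda>_. lborel))"
    by (intro nn_integral_cmult m2)
  also have "(\<integral>\<^sup>+ x. (\<integral>\<^sup>+ y. f (x(i := t i + c * y)) \<partial>lborel) \<partial>PiM I (\<lambda>_. lborel))
    = ennreal (\<bar>c\<bar> ^ card I) * (\<integral>\<^sup>+ x. (\<integral>\<^sup>+ y. f ((\<lambda>j\<in>I. t j + c * x j)(i := t i + c * y)) \<partial>lborel) \<partial>PiM I (\<lambda>_. lborel))"
    by (rule insert.IH[OF m2])
  also have "(\<integral>\<^sup>+ x. (\<integral>\<^sup>+ y. f ((\<lambda>j\<in>I. t j + c * x j)(i := t i + c * y)) \<partial>lborel) \<partial>PiM I (\<lambda>_. lborel))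
    = (\<integral>\<^sup>+ x. (\<integral>\<^sup>+ y. f (\<lambda>j\<in>insert i I. t j + c * (x(i := y)) j) \<partial>lborel) \<partial>PiM I (\<lambda>_. lborel))"
    using insert.hyps
    by (intro nn_integral_cong arg_cong[where f = f]) (auto simp: fun_eq_iff)
  also have "\<dots> = (\<integral>\<^sup>+ b. f (\<lambda>j\<in>insert i I. t j + c * b j) \<partial>PiM (insert i I) (\<lambda>_. lborel))"
    by (rule product_nn_integral_insert[symmetric])
      (use insert measurable_compose[OF aff insert.prems] in auto)
  finally show ?case
    by (simp only: card_insert_disjoint[OF insert.hyps(1,2)] power_Suc mult.assoc
        ennreal_mult[OF abs_ge_zero zero_le_power[OF abs_ge_zero]])
qed

lemma nn_integral_normal_density: "\<sigma> > 0 \<Longrightarrow> (\<integral>\<^sup>+ y. ennreal (normal_density \<mu> \<sigma> y) \<partial>lborel) = 1"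
  using prob_space.emeasure_space_1[OF prob_space_normal_density[of \<sigma> \<mu>]]
  by (simp add: emeasure_density)

text \<open>Completing the square turns the weighted density into a multiple of the normal density
  with mean u \<sigma>^2 and the same variance.\<close>

lemma nn_integral_normal_exp:
  assumes "\<sigma> > 0"
  shows "(\<integral>\<^sup>+ y. ennreal (exp (u * y)) \<partial>density lborel (normal_density 0 \<sigma>)) = ennreal (exp (u\<^sup>2 * \<sigma>\<^sup>2 / 2))"
proof -
  have *: "normal_density 0 \<sigma> y * exp (u * y) = exp (u\<^sup>2 * \<sigma>\<^sup>2 / 2) * normal_density (u * \<sigma>\<^sup>2) \<sigma> y" for y
  proof -
    have "- (y - 0)\<^sup>2 / (2 * \<sigma>\<^sup>2) + u * y = u\<^sup>2 * \<sigma>\<^sup>2 / 2 + - (y - u * \<sigma>\<^sup>2)\<^sup>2 / (2 * \<sigma>\<^sup>2)"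
      using assms by (simp add: field_simps power2_eq_square)
    then have "exp (- (y - 0)\<^sup>2 / (2 * \<sigma>\<^sup>2)) * exp (u * y) = exp (u\<^sup>2 * \<sigma>\<^sup>2 / 2) * exp (- (y - u * \<sigma>\<^sup>2)\<^sup>2 / (2 * \<sigma>\<^sup>2))"
      by (simp only: exp_add[symmetric])
    then show ?thesis unfolding normal_density_def by (simp add: mult.assoc mult.left_commute)
  qed
  have "(\<integral>\<^sup>+ y. ennreal (exp (u * y)) \<partial>density lborel (normal_density 0 \<sigma>))
    = (\<integral>\<^sup>+ y. ennreal (exp (u\<^sup>2 * \<sigma>\<^sup>2 / 2)) * ennreal (normal_density (u * \<sigma>\<^sup>2) \<sigma> y) \<partial>lborel)"
    by (subst nn_integral_density) (auto simp: ennreal_mult'[symmetric] * intro!: nn_integral_cong)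
  also have "\<dots> = ennreal (exp (u\<^sup>2 * \<sigma>\<^sup>2 / 2))"
    using assms by (subst nn_integral_cmult) (auto simp: nn_integral_normal_density)
  finally show ?thesis .
qed

text \<open>The weighted density is a multiple of a centred normal density whose variance is divided
  by \<open>d = 1 + 2 * l * \<sigma>\<^sup>2\<close>; this is the Laplace transform of a scaled
  \<chi>^2 variable with one degree of freedom.\<close>

lemma nn_integral_normal_exp_square:
  assumes "\<sigma> > 0" "l > 0"
  shows "(\<integral>\<^sup>+ y. ennreal (exp (- l * y\<^sup>2)) \<partial>density lborel (normal_density 0 \<sigma>))
    = ennreal (1 / sqrt (1 + 2 * l * \<sigma>\<^sup>2))"
proof -
  define d where "d = 1 + 2 * l * \<sigma>\<^sup>2"
  have d: "d > 1" unfolding d_def using assms by simp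
  define \<tau> where "\<tau> = \<sigma> / sqrt d"
  have \<tau>: "\<tau> > 0" unfolding \<tau>_def using d assms by simp
  have \<tau>2: "\<tau>\<^sup>2 = \<sigma>\<^sup>2 / d" unfolding \<tau>_def using d by (simp add: power_divide)
  have *: "normal_density 0 \<sigma> y * exp (- l * y\<^sup>2) = 1 / sqrt d * normal_density 0 \<tau> y" for y
  proof -
    have "- (y - 0)\<^sup>2 / (2 * \<sigma>\<^sup>2) + (- l * y\<^sup>2) = - (y - 0)\<^sup>2 / (2 * \<tau>\<^sup>2)"
      unfolding \<tau>2 using assms d by (simp add: field_simps d_def)
    then have e: "exp (- (y - 0)\<^sup>2 / (2 * \<sigma>\<^sup>2)) * exp (- l * y\<^sup>2) = exp (- (y - 0)\<^sup>2 / (2 * \<tau>\<^sup>2))"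
      by (simp only: exp_add[symmetric])
    have "1 / sqrt (2 * pi * \<sigma>\<^sup>2) = 1 / sqrt d * (1 / sqrt (2 * pi * \<tau>\<^sup>2))"
      unfolding \<tau>2 using d by (simp add: real_sqrt_divide real_sqrt_mult)
    with e show ?thesis unfolding normal_density_def by (simp add: mult.assoc)
  qed
  have "(\<integral>\<^sup>+ y. ennreal (exp (- l * y\<^sup>2)) \<partial>density lborel (normal_density 0 \<sigma>))
    = (\<integral>\<^sup>+ y. ennreal (1 / sqrt d) * ennreal (normal_density 0 \<tau> y) \<partial>lborel)"
    using d * by (subst nn_integral_density) (auto simp: ennreal_mult'[symmetric] intro!: nn_integral_cong)
  also have "\<dots> = ennreal (1 / sqrt d)"
    using \<tau> by (subst nn_integral_cmult) (auto simp: nn_integral_normal_density)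
  finally show ?thesis unfolding d_def .
qed

lemma nn_integral_exp_neg_square_finite:
  assumes "L > 0"
  shows "(\<integral>\<^sup>+ y. ennreal (exp (- (y\<^sup>2 / L))) \<partial>lborel) < \<infinity>"
proof -
  define \<sigma> where "\<sigma> = sqrt (L / 2)"
  have \<sigma>: "\<sigma> > 0" "\<sigma>\<^sup>2 = L / 2" using assms by (auto simp: \<sigma>_def)
  have "exp (- (y\<^sup>2 / L)) = sqrt (2 * pi * \<sigma>\<^sup>2) * normal_density 0 \<sigma> y" for y
    unfolding normal_density_def using \<sigma> assms by simp
  then have "(\<integral>\<^sup>+ y. ennreal (exp (- (y\<^sup>2 / L))) \<partial>lborel)
    = (\<integral>\<^sup>+ y. ennreal (sqrt (2 * pi * \<sigma>\<^sup>2)) * ennreal (normal_density 0 \<sigma> y) \<partial>lborel)"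
    by (auto simp: ennreal_mult'[symmetric] intro!: nn_integral_cong)
  also have "\<dots> = ennreal (sqrt (2 * pi * \<sigma>\<^sup>2))"
    using \<sigma> by (subst nn_integral_cmult) (auto simp: nn_integral_normal_density)
  finally show ?thesis by simp
qed

section \<open>Gaussian integrals over the coefficient vector\<close>

definition fitted :: "(nat \<times> nat \<Rightarrow> real) \<Rightarrow> nat set \<Rightarrow> (nat \<Rightarrow> real) \<Rightarrow> nat \<Rightarrow> real" where
  "fitted x g b i = (\<Sum>j\<in>g. x (i, j) * b j)"

text \<open>The design is a function on index pairs, hence a point of a product measurable space.
  Values in \<open>ennreal\<close> allow for degenerate designs, where the integral
  diverges.\<close>

definition gauss_mass :: "nat \<Rightarrow> nat set \<Rightarrow> (nat \<times> nat \<Rightarrow> real) \<Rightarrow> ennreal" where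
  "gauss_mass n g x = (\<integral>\<^sup>+ b. ennreal (exp (- (\<Sum>i<n. (fitted x g b i)\<^sup>2))) \<partial>PiM g (\<lambda>_. lborel))"

text \<open>For linearly independent columns its quotient by \<open>gauss_mass\<close> is exp (r^2
  T), with T the squared norm of the projection of \<open>e\<close> onto the columns in
  \<open>g\<close>. The exponent is linear in \<open>e\<close>, so the noise can be integrated
  coordinate by coordinate.\<close>

definition fit_mass :: "nat \<Rightarrow> nat set \<Rightarrow> real \<Rightarrow> (nat \<times> nat \<Rightarrow> real) \<Rightarrow> (nat \<Rightarrow> real) \<Rightarrow> ennreal" where
  "fit_mass n g r x e = (\<integral>\<^sup>+ b. ennreal (exp (2 * r * (\<Sum>i<n. fitted x g b i * e i) - (\<Sum>i<n. (fitted x g b i)\<^sup>2)))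
      \<partial>PiM g (\<lambda>_. lborel))"

definition noise :: "real \<Rightarrow> nat \<Rightarrow> (nat \<Rightarrow> real) measure" where
  "noise \<sigma> n = PiM {..<n} (\<lambda>_. density lborel (normal_density 0 \<sigma>))"

lemma fitted_add_scale:
  "fitted x g (\<lambda>j\<in>g. t j + c * b j) i = fitted x g t i + c * fitted x g b i"
  unfolding fitted_def by (simp add: algebra_simps sum.distrib sum_distrib_left)

lemma fitted_measurable [measurable]:
  assumes "i < n" "g \<subseteq> {..<p}"
  shows "(\<lambda>z. fitted (fst z) g (snd z) i) \<in>
    borel_measurable (PiM ({..<n} \<times> {..<p}) (\<lambda>_. borel) \<Otimes>\<^sub>M PiM g (\<lambda>_. lborel))"
  unfolding fitted_def
proof (intro borel_measurable_sum borel_measurable_times)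
  fix j assume "j \<in> g"
  then have [measurable]: "(i, j) \<in> {..<n} \<times> {..<p}" "j \<in> g" using assms by auto
  show "(\<lambda>z. fst z (i, j)) \<in> borel_measurable (PiM ({..<n} \<times> {..<p}) (\<lambda>_. borel :: real measure) \<Otimes>\<^sub>M PiM g (\<lambda>_. lborel))"
    by measurable
  show "(\<lambda>z. snd z j) \<in> borel_measurable (PiM ({..<n} \<times> {..<p}) (\<lambda>_. borel :: real measure) \<Otimes>\<^sub>M PiM g (\<lambda>_. lborel))"
    by measurable
qed

lemma fitted_measurable_right [measurable]:
  "(\<lambda>b. fitted x g b i) \<in> borel_measurable (PiM g (\<lambda>_. lborel))"
  unfolding fitted_def by (intro borel_measurable_sum borel_measurable_times) measurable

lemma sigma_finite_PiM_lborel: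
  assumes "finite g"
  shows "sigma_finite_measure (PiM g (\<lambda>_. lborel :: real measure))"
proof -
  interpret finite_product_sigma_finite "\<lambda>_. lborel :: real measure" g
    by standard (rule assms)
  show ?thesis by standard
qed

lemma gauss_mass_measurable:
  assumes "g \<subseteq> {..<p}"
  shows "gauss_mass n g \<in> borel_measurable (PiM ({..<n} \<times> {..<p}) (\<lambda>_. borel))"
proof -
  have "finite g" using assms finite_subset by blast
  interpret sigma_finite_measure "PiM g (\<lambda>_. lborel :: real measure)"
    by (rule sigma_finite_PiM_lborel) fact
  have "(\<lambda>z. ennreal (exp (- (\<Sum>i<n. (fitted (fst z) g (snd z) i)\<^sup>2))))
    \<in> borel_measurable (PiM ({..<n} \<times> {..<p}) (\<lambda>_. borel) \<Otimes>\<^sub>M PiM g (\<lambda>_. lborel))"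
    using fitted_measurable[OF _ assms, of _ n] by measurable
  then show ?thesis
    unfolding gauss_mass_def[abs_def]
    by (intro borel_measurable_nn_integral) (simp add: case_prod_beta')
qed

text \<open>A parametric integral of a jointly measurable integrand is measurable in its parameters,
  so no measurability of matrix inverses or projections has to be established.\<close>

lemma fit_mass_measurable:
  assumes "g \<subseteq> {..<p}"
  shows "(\<lambda>z. fit_mass n g r (fst z) (snd z))
    \<in> borel_measurable (PiM ({..<n} \<times> {..<p}) (\<lambda>_. borel) \<Otimes>\<^sub>M PiM {..<n} (\<lambda>_. borel))"
proof -
  let ?X = "PiM ({..<n} \<times> {..<p}) (\<lambda>_. borel :: real measure)"
  let ?E = "PiM {..<n} (\<lambda>_. borel :: real measure)"
  let ?B = "PiM g (\<lambda>_. lborel :: real measure)"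
  have "finite g" using assms finite_subset by blast
  interpret sigma_finite_measure ?B by (rule sigma_finite_PiM_lborel) fact
  have l: "(\<lambda>w. fitted (fst (fst w)) g (snd w) i) \<in> borel_measurable ((?X \<Otimes>\<^sub>M ?E) \<Otimes>\<^sub>M ?B)" if "i < n" for i
  proof -
    have "(\<lambda>w. (fst (fst w), snd w)) \<in> measurable ((?X \<Otimes>\<^sub>M ?E) \<Otimes>\<^sub>M ?B) (?X \<Otimes>\<^sub>M ?B)" by measurable
    from measurable_compose[OF this fitted_measurable[OF that assms]] show ?thesis by simp
  qed
  have e: "(\<lambda>w. snd (fst w) i) \<in> borel_measurable ((?X \<Otimes>\<^sub>M ?E) \<Otimes>\<^sub>M ?B)" if "i < n" for i
  proof -
    have [measurable]: "i \<in> {..<n}" using that by simp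
    show ?thesis by measurable
  qed
  have "(\<lambda>w. ennreal (exp (2 * r * (\<Sum>i<n. fitted (fst (fst w)) g (snd w) i * snd (fst w) i)
        - (\<Sum>i<n. (fitted (fst (fst w)) g (snd w) i)\<^sup>2))))
    \<in> borel_measurable ((?X \<Otimes>\<^sub>M ?E) \<Otimes>\<^sub>M ?B)"
    using l e by measurable
  then show ?thesis
    unfolding fit_mass_def[abs_def]
    by (intro borel_measurable_nn_integral) (simp add: case_prod_beta')
qed

text \<open>Completing the square: shifting \<open>b\<close> by a multiple of the least squares coefficients \<open>b0\<close>
  separates the squared norm of the fit from an integral that no longer involves \<open>e\<close>.\<close>

lemma fit_mass_eq:
  assumes "finite g"
    and normal: "\<And>b. (\<Sum>i<n. fitted x g b i * (e i - fitted x g b0 i)) = 0"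
  shows "fit_mass n g r x e = ennreal (exp (r\<^sup>2 * (\<Sum>i<n. (fitted x g b0 i)\<^sup>2))) * gauss_mass n g x"
proof -
  have sq: "2 * r * (\<Sum>i<n. fitted x g (\<lambda>j\<in>g. r * b0 j + 1 * b j) i * e i)
      - (\<Sum>i<n. (fitted x g (\<lambda>j\<in>g. r * b0 j + 1 * b j) i)\<^sup>2)
      = r\<^sup>2 * (\<Sum>i<n. (fitted x g b0 i)\<^sup>2) + - (\<Sum>i<n. (fitted x g b i)\<^sup>2)" for b
  proof -
    have lr: "fitted x g (\<lambda>j. r * b0 j) i = r * fitted x g b0 i" for i
      unfolding fitted_def by (simp add: sum_distrib_left mult.left_commute)
    \<comment> \<open>In inner products with fits, \<open>e\<close> may be replaced by its
      projection, by the normal equations.\<close>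
    have n: "(\<Sum>i<n. fitted x g b' i * e i) = (\<Sum>i<n. fitted x g b' i * fitted x g b0 i)" for b'
      using normal[of b'] by (simp add: right_diff_distrib sum_subtractf)
    have s: "(\<Sum>i<n. (r * fitted x g b0 i + fitted x g b i)\<^sup>2)
      = r\<^sup>2 * (\<Sum>i<n. (fitted x g b0 i)\<^sup>2) + 2 * r * (\<Sum>i<n. fitted x g b i * fitted x g b0 i) + (\<Sum>i<n. (fitted x g b i)\<^sup>2)"
      by (simp add: power2_sum sum.distrib sum_distrib_left power_mult_distrib algebra_simps)
    have t: "(\<Sum>i<n. (r * fitted x g b0 i + fitted x g b i) * fitted x g b0 i)
      = r * (\<Sum>i<n. (fitted x g b0 i)\<^sup>2) + (\<Sum>i<n. fitted x g b i * fitted x g b0 i)"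
      by (simp add: power2_eq_square sum.distrib sum_distrib_left algebra_simps)
    show ?thesis
      unfolding n unfolding fitted_add_scale unfolding lr mult_1 s t by (simp add: algebra_simps power2_eq_square)
  qed
  have "fit_mass n g r x e = ennreal (\<bar>1\<bar> ^ card g) * (\<integral>\<^sup>+ b. ennreal (exp (2 * r * (\<Sum>i<n. fitted x g (\<lambda>j\<in>g. r * b0 j + 1 * b j) i * e i)
      - (\<Sum>i<n. (fitted x g (\<lambda>j\<in>g. r * b0 j + 1 * b j) i)\<^sup>2))) \<partial>PiM g (\<lambda>_. lborel))"
    unfolding fit_mass_def by (rule nn_integral_PiM_lborel_affine) (auto intro!: assms)
  also have "\<dots> = (\<integral>\<^sup>+ b. ennreal (exp (r\<^sup>2 * (\<Sum>i<n. (fitted x g b0 i)\<^sup>2)))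
      * ennreal (exp (- (\<Sum>i<n. (fitted x g b i)\<^sup>2))) \<partial>PiM g (\<lambda>_. lborel))"
    unfolding sq exp_add by (simp add: ennreal_mult)
  also have "\<dots> = ennreal (exp (r\<^sup>2 * (\<Sum>i<n. (fitted x g b0 i)\<^sup>2))) * gauss_mass n g x"
    unfolding gauss_mass_def by (rule nn_integral_cmult) measurable
  finally show ?thesis .
qed

text \<open>A positive integrand has a nonzero integral over a space of nonzero measure. For
  finiteness, \<open>bd\<close> bounds the integrand by a product of one-dimensional Gaussian
  functions.\<close>

lemma gauss_mass_pos_finite:
  assumes g: "finite g" and L: "L > 0"
    and bd: "\<And>b. (\<Sum>j\<in>g. (b j)\<^sup>2) \<le> L * (\<Sum>i<n. (fitted x g b i)\<^sup>2)"
  shows "0 < gauss_mass n g x" "gauss_mass n g x < \<infinity>"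
proof -
  interpret product_sigma_finite "\<lambda>_. lborel :: real measure" by standard
  have "gauss_mass n g x \<noteq> 0"
  proof
    assume "gauss_mass n g x = 0"
    then have "AE b in PiM g (\<lambda>_. lborel :: real measure). ennreal (exp (- (\<Sum>i<n. (fitted x g b i)\<^sup>2))) = 0"
      unfolding gauss_mass_def by (subst (asm) nn_integral_0_iff_AE) measurable
    then have "AE b in PiM g (\<lambda>_. lborel :: real measure). False" by eventually_elim simp
    then obtain N where "space (PiM g (\<lambda>_. lborel :: real measure)) \<subseteq> N"
      "emeasure (PiM g (\<lambda>_. lborel :: real measure)) N = 0" "N \<in> sets (PiM g (\<lambda>_. lborel :: real measure))"
      by (elim AE_E) auto
    then have "emeasure (PiM g (\<lambda>_. lborel :: real measure)) (space (PiM g (\<lambda>_. lborel :: real measure))) = 0"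
      using emeasure_mono le_zero_eq by metis
    \<comment> \<open>The whole space has measure 1 for empty \<open>g\<close> and infinite measure
      otherwise, never 0.\<close>
    then show False
      using emeasure_PiM[OF g, of "\<lambda>_. UNIV"] by (simp add: space_PiM)
  qed
  then show "0 < gauss_mass n g x" by (simp add: zero_less_iff_neq_zero)
  have "gauss_mass n g x \<le> (\<integral>\<^sup>+ b. (\<Prod>j\<in>g. ennreal (exp (- ((b j)\<^sup>2 / L)))) \<partial>PiM g (\<lambda>_. lborel))"
    unfolding gauss_mass_def
  proof (intro nn_integral_mono)
    fix b :: "nat \<Rightarrow> real"
    have "exp (- (\<Sum>i<n. (fitted x g b i)\<^sup>2)) \<le> exp (\<Sum>j\<in>g. - ((b j)\<^sup>2 / L))"
      using bd[of b] L by (simp add: sum_negf sum_divide_distrib[symmetric] field_simps)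
    then show "ennreal (exp (- (\<Sum>i<n. (fitted x g b i)\<^sup>2))) \<le> (\<Prod>j\<in>g. ennreal (exp (- ((b j)\<^sup>2 / L))))"
      using g by (simp add: prod_ennreal exp_sum ennreal_leI)
  qed
  also have "\<dots> = (\<Prod>j\<in>g. \<integral>\<^sup>+ y. ennreal (exp (- (y\<^sup>2 / L))) \<partial>lborel)"
    by (rule product_nn_integral_prod[OF g]) measurable
  also have "\<dots> < \<infinity>"
  proof -
    obtain a where "(\<integral>\<^sup>+ y. ennreal (exp (- (y\<^sup>2 / L))) \<partial>lborel) = ennreal a" "a \<ge> 0"
      using nn_integral_exp_neg_square_finite[OF L] by (metis ennreal_cases infinity_ennreal_def less_irrefl)
    then show ?thesis by (simp add: ennreal_power)
  qed
  finally show "gauss_mass n g x < \<infinity>" .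
qed

lemma prob_space_noise: "\<sigma> > 0 \<Longrightarrow> prob_space (noise \<sigma> n)"
  unfolding noise_def by (intro prob_space_PiM prob_space_normal_density)

lemma sets_noise: "sets (noise \<sigma> n) = sets (PiM {..<n} (\<lambda>_. borel))"
  unfolding noise_def by (intro sets_PiM_cong) auto

lemma nn_integral_noise_prod:
  assumes \<sigma>: "\<sigma> > 0" and f: "\<And>i. i < n \<Longrightarrow> f i \<in> borel_measurable borel"
  shows "(\<integral>\<^sup>+ e. (\<Prod>i<n. f i (e i)) \<partial>noise \<sigma> n) = (\<Prod>i<n. \<integral>\<^sup>+ y. f i y \<partial>density lborel (normal_density 0 \<sigma>))"
proof -
  interpret prob_space "density lborel (normal_density 0 \<sigma>)" by (rule prob_space_normal_density[OF \<sigma>])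
  interpret product_sigma_finite "\<lambda>_::nat. density lborel (normal_density 0 \<sigma>)" by standard
  show ?thesis unfolding noise_def
    by (rule product_nn_integral_prod) (use f in auto)
qed

text \<open>Linearising the square: integrating over the noise first only needs the moment generating
  function of a single Gaussian variable, and the remaining integral is a rescaled Gaussian one.\<close>

lemma nn_integral_fit_mass:
  assumes g: "finite g" and \<sigma>: "\<sigma> > 0" and s: "r\<^sup>2 * \<sigma>\<^sup>2 = s" "s < 1/2"
  shows "(\<integral>\<^sup>+ e. fit_mass n g r x e \<partial>noise \<sigma> n) = ennreal ((1 / sqrt (1 - 2 * s)) ^ card g) * gauss_mass n g x"
proof -
  let ?B = "PiM g (\<lambda>_. lborel :: real measure)"
  let ?N = "noise \<sigma> n"
  interpret B: sigma_finite_measure ?B by (rule sigma_finite_PiM_lborel) fact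
  interpret N: prob_space ?N by (rule prob_space_noise) fact
  interpret BN: pair_sigma_finite ?B ?N by standard
  note [measurable_cong] = sets_noise
  have e: "(\<lambda>w. snd w i) \<in> borel_measurable (?B \<Otimes>\<^sub>M ?N)" if "i < n" for i
  proof -
    have [measurable]: "i \<in> {..<n}" using that by simp
    show ?thesis by measurable
  qed
  have "(\<lambda>w. ennreal (exp (2 * r * (\<Sum>i<n. fitted x g (fst w) i * snd w i)
        - (\<Sum>i<n. (fitted x g (fst w) i)\<^sup>2)))) \<in> borel_measurable (?B \<Otimes>\<^sub>M ?N)"
    using e by measurable
  then have m: "(\<lambda>(b, e). ennreal (exp (2 * r * (\<Sum>i<n. fitted x g b i * e i)
        - (\<Sum>i<n. (fitted x g b i)\<^sup>2)))) \<in> borel_measurable (?B \<Otimes>\<^sub>M ?N)"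
    by (simp add: case_prod_beta')
  have inner: "(\<integral>\<^sup>+ e. ennreal (exp (2 * r * (\<Sum>i<n. fitted x g b i * e i) - (\<Sum>i<n. (fitted x g b i)\<^sup>2))) \<partial>?N)
      = ennreal (exp (- ((1 - 2 * s) * (\<Sum>i<n. (fitted x g b i)\<^sup>2))))" for b
  proof -
    have "(\<integral>\<^sup>+ e. ennreal (exp (2 * r * (\<Sum>i<n. fitted x g b i * e i) - (\<Sum>i<n. (fitted x g b i)\<^sup>2))) \<partial>?N)
      = (\<integral>\<^sup>+ e. (\<Prod>i<n. ennreal (exp (- (fitted x g b i)\<^sup>2)) * ennreal (exp (2 * r * fitted x g b i * e i))) \<partial>?N)"
      by (intro nn_integral_cong)
        (simp add: ennreal_mult'[symmetric] exp_add[symmetric] prod_ennreal exp_sum[symmetric]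
          sum_subtractf sum_distrib_left mult.assoc)
    also have "\<dots> = (\<Prod>i<n. \<integral>\<^sup>+ y. ennreal (exp (- (fitted x g b i)\<^sup>2)) * ennreal (exp (2 * r * fitted x g b i * y))
         \<partial>density lborel (normal_density 0 \<sigma>))"
      by (rule nn_integral_noise_prod[OF \<sigma>]) measurable
    also have "\<dots> = (\<Prod>i<n. ennreal (exp (- ((1 - 2 * s) * (fitted x g b i)\<^sup>2))))"
    proof (intro prod.cong refl)
      fix i
      \<comment> \<open>The moment generating function at \<open>2 * r * fitted x g b i\<close>
        contributes 2 s times the squared fit, so the decay is weakened by the factor
        \<open>1 - 2 * s\<close>, which is positive because \<open>s < 1/2\<close>.\<close>
      have "- (fitted x g b i)\<^sup>2 + (2 * r * fitted x g b i)\<^sup>2 * \<sigma>\<^sup>2 / 2 = - ((1 - 2 * s) * (fitted x g b i)\<^sup>2)"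
        unfolding s(1)[symmetric] by (simp add: algebra_simps power_mult_distrib)
      then show "(\<integral>\<^sup>+ y. ennreal (exp (- (fitted x g b i)\<^sup>2)) * ennreal (exp (2 * r * fitted x g b i * y))
         \<partial>density lborel (normal_density 0 \<sigma>)) = ennreal (exp (- ((1 - 2 * s) * (fitted x g b i)\<^sup>2)))"
        by (subst nn_integral_cmult) (auto simp: nn_integral_normal_exp[OF \<sigma>] ennreal_mult'[symmetric] exp_add[symmetric])
    qed
    also have "\<dots> = ennreal (exp (- ((1 - 2 * s) * (\<Sum>i<n. (fitted x g b i)\<^sup>2))))"
      by (simp add: prod_ennreal exp_sum[symmetric] sum_negf sum_distrib_left)
    finally show ?thesis .
  qed
  \<comment> \<open>Scaling the coefficients by this \<open>c\<close> restores the integrand of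
    \<open>gauss_mass\<close>; its power \<open>c ^ card g\<close> is the \<chi>^2 moment generating
    function.\<close>
  define c where "c = 1 / sqrt (1 - 2 * s)"
  have c: "c > 0" "(1 - 2 * s) * c\<^sup>2 = 1" using s unfolding c_def by (auto simp: power_divide)
  have lc: "fitted x g (\<lambda>j\<in>g. 0 + c * b j) i = c * fitted x g b i" for b i
    using fitted_add_scale[of x g "\<lambda>_. 0" c b i] by (simp add: fitted_def)
  have "(\<integral>\<^sup>+ e. fit_mass n g r x e \<partial>?N)
    = (\<integral>\<^sup>+ b. \<integral>\<^sup>+ e. ennreal (exp (2 * r * (\<Sum>i<n. fitted x g b i * e i) - (\<Sum>i<n. (fitted x g b i)\<^sup>2))) \<partial>?N \<partial>?B)"
    unfolding fit_mass_def by (rule BN.Fubini'[OF m])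
  also have "\<dots> = (\<integral>\<^sup>+ b. ennreal (exp (- ((1 - 2 * s) * (\<Sum>i<n. (fitted x g b i)\<^sup>2)))) \<partial>?B)"
    unfolding inner ..
  also have "\<dots> = ennreal (\<bar>c\<bar> ^ card g) *
    (\<integral>\<^sup>+ b. ennreal (exp (- ((1 - 2 * s) * (\<Sum>i<n. (fitted x g (\<lambda>j\<in>g. 0 + c * b j) i)\<^sup>2)))) \<partial>?B)"
    by (rule nn_integral_PiM_lborel_affine[OF g, where t = "\<lambda>_. 0"]) (use c in auto)
  also have "(\<integral>\<^sup>+ b. ennreal (exp (- ((1 - 2 * s) * (\<Sum>i<n. (fitted x g (\<lambda>j\<in>g. 0 + c * b j) i)\<^sup>2)))) \<partial>?B) = gauss_mass n g x"
    unfolding gauss_mass_def lc power_mult_distrib sum_distrib_left[symmetric] mult.assoc[symmetric] c(2) by simp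
  finally show ?thesis using c(1) unfolding c_def by simp
qed

text \<open>Markov's inequality with the design fixed. The conditions on \<open>gauss_mass\<close>
  are part of the event, so the bound holds for every \<open>x\<close>: for a degenerate design the
  event is empty.\<close>

lemma noise_fit_mass_tail:
  assumes g: "g \<subseteq> {..<p}" and \<sigma>: "\<sigma> > 0" and s: "r\<^sup>2 * \<sigma>\<^sup>2 = s" "s < 1/2" and K: "K > 0"
    and x: "x \<in> space (PiM ({..<n} \<times> {..<p}) (\<lambda>_. borel))"
  shows "emeasure (noise \<sigma> n) {e \<in> space (noise \<sigma> n). 0 < gauss_mass n g x \<and> gauss_mass n g x < \<infinity>
      \<and> ennreal K * gauss_mass n g x \<le> fit_mass n g r x e} \<le> ennreal ((1 / sqrt (1 - 2 * s)) ^ card g / K)"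
proof (cases "0 < gauss_mass n g x \<and> gauss_mass n g x < \<infinity>")
  case True
  have fg: "finite g" using g finite_subset by blast
  let ?G = "gauss_mass n g x"
  obtain G where G: "?G = ennreal G" "G > 0"
    using True by (metis ennreal_cases ennreal_less_zero_iff infinity_ennreal_def less_irrefl)
  note [measurable_cong] = sets_noise
  have "(\<lambda>e. (x, e)) \<in> measurable (noise \<sigma> n) (PiM ({..<n} \<times> {..<p}) (\<lambda>_. borel :: real measure) \<Otimes>\<^sub>M PiM {..<n} (\<lambda>_. borel :: real measure))"
    using x by measurable
  from measurable_compose[OF this fit_mass_measurable[OF g]]
  have m: "fit_mass n g r x \<in> borel_measurable (noise \<sigma> n)" by simp
  have "{e \<in> space (noise \<sigma> n). 0 < ?G \<and> ?G < \<infinity> \<and> ennreal K * ?G \<le> fit_mass n g r x e}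
      \<subseteq> {e \<in> space (noise \<sigma> n). 1 \<le> ennreal (1 / (K * G)) * fit_mass n g r x e}"
  proof safe
    fix e assume "ennreal K * ?G \<le> fit_mass n g r x e"
    then have "ennreal (1 / (K * G)) * (ennreal K * ennreal G) \<le> ennreal (1 / (K * G)) * fit_mass n g r x e"
      unfolding G by (intro mult_left_mono) auto
    also have "ennreal (1 / (K * G)) * (ennreal K * ennreal G) = 1"
      using K G by (simp add: ennreal_mult'[symmetric])
    finally show "1 \<le> ennreal (1 / (K * G)) * fit_mass n g r x e" .
  qed
  then have "emeasure (noise \<sigma> n) {e \<in> space (noise \<sigma> n). 0 < ?G \<and> ?G < \<infinity> \<and> ennreal K * ?G \<le> fit_mass n g r x e}
     \<le> emeasure (noise \<sigma> n) {e \<in> space (noise \<sigma> n). 1 \<le> ennreal (1 / (K * G)) * fit_mass n g r x e}"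
    by (rule emeasure_mono) (use m in measurable)
  also have "\<dots> \<le> ennreal (1 / (K * G)) * (\<integral>\<^sup>+ e. fit_mass n g r x e * indicator (space (noise \<sigma> n)) e \<partial>noise \<sigma> n)"
    by (rule nn_integral_Markov_inequality) (use m in measurable)
  also have "(\<integral>\<^sup>+ e. fit_mass n g r x e * indicator (space (noise \<sigma> n)) e \<partial>noise \<sigma> n)
      = (\<integral>\<^sup>+ e. fit_mass n g r x e \<partial>noise \<sigma> n)"
    by (intro nn_integral_cong) simp
  also have "\<dots> = ennreal ((1 / sqrt (1 - 2 * s)) ^ card g) * ennreal G"
    unfolding nn_integral_fit_mass[OF fg \<sigma> s] G ..
  also have "ennreal (1 / (K * G)) * \<dots> = ennreal ((1 / sqrt (1 - 2 * s)) ^ card g / K)"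
    using K G s by (simp add: ennreal_mult'[symmetric])
  finally show ?thesis .
qed auto

subsection \<open>Tail bounds\<close>

text \<open>Chernoff's bound with the weight exp (- l |e|^2). Independence makes the bound the n-th
  power of a single factor \<open>q\<close>, which therefore does not depend on
  \<open>n\<close>.\<close>

lemma noise_norm_lower_tail:
  assumes \<sigma>: "\<sigma> > 0" and \<epsilon>: "0 < \<epsilon>" "\<epsilon> < 1"
  obtains q where "0 \<le> q" "q < 1"
    "\<And>n. emeasure (noise \<sigma> n) {e \<in> space (noise \<sigma> n). (\<Sum>i<n. (e i)\<^sup>2) \<le> (1 - \<epsilon>) * n * \<sigma>\<^sup>2} \<le> ennreal (q ^ n)"
proof -
  \<comment> \<open>With 0 < u < \<epsilon> one has u (1 - \<epsilon>) < u - u^2 \<le> ln (1 + u),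
    and this is what makes \<open>q < 1\<close>; \<open>l\<close> is then fixed by 2 l \<sigma>^2 =
    u.\<close>
  define u where "u = \<epsilon> / 2"
  define l where "l = u / (2 * \<sigma>\<^sup>2)"
  have u: "0 < u" "u \<le> 1" using \<epsilon> by (auto simp: u_def)
  have l: "l > 0" "2 * l * \<sigma>\<^sup>2 = u" using u \<sigma> by (auto simp: l_def)
  define q where "q = exp (u * (1 - \<epsilon>) / 2) / sqrt (1 + u)"
  have "u * u < u * \<epsilon>" using u \<epsilon> by (intro mult_strict_left_mono) (auto simp: u_def)
  then have "u * (1 - \<epsilon>) < u - u\<^sup>2" by (simp add: power2_eq_square right_diff_distrib)
  also have "\<dots> \<le> ln (1 + u)" using u by (intro ln_one_plus_pos_lower_bound) auto
  finally have "exp (u * (1 - \<epsilon>)) < exp (ln (1 + u))" by simp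
  then have "exp (u * (1 - \<epsilon>)) < 1 + u" using u by simp
  then have "sqrt (exp (u * (1 - \<epsilon>))) < sqrt (1 + u)" by simp
  also have "sqrt (exp (u * (1 - \<epsilon>))) = exp (u * (1 - \<epsilon>) / 2)"
    by (rule real_sqrt_unique) (auto simp: power2_eq_square exp_add[symmetric])
  finally have q: "0 \<le> q" "q < 1" unfolding q_def using u by auto
  have "emeasure (noise \<sigma> n) {e \<in> space (noise \<sigma> n). (\<Sum>i<n. (e i)\<^sup>2) \<le> (1 - \<epsilon>) * n * \<sigma>\<^sup>2} \<le> ennreal (q ^ n)" for n
  proof -
    let ?N = "noise \<sigma> n"
    note [measurable_cong] = sets_noise
    define c where "c = exp (l * (1 - \<epsilon>) * n * \<sigma>\<^sup>2)"
    have "(\<lambda>e. e i) \<in> borel_measurable ?N" if "i < n" for i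
    proof -
      have [measurable]: "i \<in> {..<n}" using that by simp
      show ?thesis by measurable
    qed
    then have m: "(\<lambda>e. \<Prod>i<n. ennreal (exp (- l * (e i)\<^sup>2))) \<in> borel_measurable ?N" by measurable
    have "{e \<in> space ?N. (\<Sum>i<n. (e i)\<^sup>2) \<le> (1 - \<epsilon>) * n * \<sigma>\<^sup>2}
      \<subseteq> {e \<in> space ?N. 1 \<le> ennreal c * (\<Prod>i<n. ennreal (exp (- l * (e i)\<^sup>2)))}"
    proof safe
      fix e assume "(\<Sum>i<n. (e i)\<^sup>2) \<le> (1 - \<epsilon>) * n * \<sigma>\<^sup>2"
      then have "0 \<le> l * ((1 - \<epsilon>) * n * \<sigma>\<^sup>2 - (\<Sum>i<n. (e i)\<^sup>2))" using l by simp
      then have "1 \<le> exp (l * ((1 - \<epsilon>) * n * \<sigma>\<^sup>2 - (\<Sum>i<n. (e i)\<^sup>2)))" by simp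
      also have "\<dots> = c * (\<Prod>i<n. exp (- l * (e i)\<^sup>2))"
        unfolding c_def exp_sum[OF finite_lessThan, symmetric] exp_add[symmetric]
        by (simp add: algebra_simps sum_negf sum_distrib_left)
      finally show "1 \<le> ennreal c * (\<Prod>i<n. ennreal (exp (- l * (e i)\<^sup>2)))"
        by (simp add: prod_ennreal ennreal_mult'[symmetric] c_def)
    qed
    then have "emeasure ?N {e \<in> space ?N. (\<Sum>i<n. (e i)\<^sup>2) \<le> (1 - \<epsilon>) * n * \<sigma>\<^sup>2}
      \<le> emeasure ?N {e \<in> space ?N. 1 \<le> ennreal c * (\<Prod>i<n. ennreal (exp (- l * (e i)\<^sup>2)))}"
      by (rule emeasure_mono) (use m in measurable)
    also have "\<dots> \<le> ennreal c * (\<integral>\<^sup>+ e. (\<Prod>i<n. ennreal (exp (- l * (e i)\<^sup>2))) * indicator (space ?N) e \<partial>?N)"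
      by (rule nn_integral_Markov_inequality) (use m in measurable)
    also have "(\<integral>\<^sup>+ e. (\<Prod>i<n. ennreal (exp (- l * (e i)\<^sup>2))) * indicator (space ?N) e \<partial>?N)
        = (\<integral>\<^sup>+ e. (\<Prod>i<n. ennreal (exp (- l * (e i)\<^sup>2))) \<partial>?N)"
      by (intro nn_integral_cong) simp
    also have "\<dots> = (\<Prod>i<n. ennreal (1 / sqrt (1 + u)))"
      using nn_integral_normal_exp_square[OF \<sigma> l(1)] unfolding l(2)
      by (subst nn_integral_noise_prod[OF \<sigma>]) auto
    also have "ennreal c * \<dots> = ennreal (q ^ n)"
    proof -
      have "c = exp (u * (1 - \<epsilon>) / 2) ^ n"
        unfolding c_def l(2)[symmetric] exp_of_nat_mult[symmetric] by (simp add: algebra_simps)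
      then show ?thesis using u
        by (simp add: ennreal_power ennreal_mult'[symmetric] q_def power_divide)
    qed
    finally show ?thesis .
  qed
  with q show thesis by (rule that)
qed

text \<open>Independence is the product formula on measurable rectangles, and rectangles determine a
  measure on the pair space.\<close>

lemma (in prob_space) indep_rv_distr_pair:
  assumes "indep_rv M Ma A Mb B"
  shows "distr M (Ma \<Otimes>\<^sub>M Mb) (\<lambda>\<omega>. (A \<omega>, B \<omega>)) = distr M Ma A \<Otimes>\<^sub>M distr M Mb B"
proof (rule pair_measure_eqI[symmetric])
  have A[measurable]: "A \<in> measurable M Ma" and B[measurable]: "B \<in> measurable M Mb"
    and ind: "indep_set {A -` S \<inter> space M | S. S \<in> sets Ma} {B -` S \<inter> space M | S. S \<in> sets Mb}"
    using assms unfolding indep_rv_def by auto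
  show "sigma_finite_measure (distr M Ma A)" "sigma_finite_measure (distr M Mb B)"
    using prob_space_distr[OF A] prob_space_distr[OF B] prob_space_imp_sigma_finite by auto
  show "sets (distr M Ma A \<Otimes>\<^sub>M distr M Mb B) = sets (distr M (Ma \<Otimes>\<^sub>M Mb) (\<lambda>\<omega>. (A \<omega>, B \<omega>)))"
    by simp
  fix S T assume S: "S \<in> sets (distr M Ma A)" and T: "T \<in> sets (distr M Mb B)"
  then have "prob ((A -` S \<inter> space M) \<inter> (B -` T \<inter> space M)) = prob (A -` S \<inter> space M) * prob (B -` T \<inter> space M)"
    by (intro indep_setD[OF ind]) auto
  moreover have "(\<lambda>\<omega>. (A \<omega>, B \<omega>)) -` (S \<times> T) \<inter> space M = (A -` S \<inter> space M) \<inter> (B -` T \<inter> space M)"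
    by auto
  ultimately show "emeasure (distr M Ma A) S * emeasure (distr M Mb B) T
      = emeasure (distr M (Ma \<Otimes>\<^sub>M Mb) (\<lambda>\<omega>. (A \<omega>, B \<omega>))) (S \<times> T)"
    using S T by (simp add: emeasure_distr emeasure_eq_measure ennreal_mult'[symmetric])
qed

text \<open>Independent coordinates have the product of their laws as joint law. The assumption
  \<open>n > 0\<close> provides the nonempty index set that
  \<open>indep_vars_iff_distr_eq_PiM'\<close> asks for.\<close>

lemma (in prob_space) distr_eq_noise:
  assumes "n > 0" and "\<And>i. i < n \<Longrightarrow> distributed M lborel (\<lambda>\<omega>. Y \<omega> i) (normal_density 0 \<sigma>)"
    and "indep_vars (\<lambda>_. borel) (\<lambda>i \<omega>. Y \<omega> i) {..<n}"
  shows "distr M (PiM {..<n} (\<lambda>_. borel)) (\<lambda>\<omega>. \<lambda>i\<in>{..<n}. Y \<omega> i) = noise \<sigma> n"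
proof -
  have d: "distr M borel (\<lambda>\<omega>. Y \<omega> i) = density lborel (normal_density 0 \<sigma>)" if "i \<in> {..<n}" for i
  proof -
    have "distr M borel (\<lambda>\<omega>. Y \<omega> i) = distr M lborel (\<lambda>\<omega>. Y \<omega> i)" by (rule distr_cong) simp_all
    then show ?thesis using distributed_distr_eq_density[OF assms(2)[of i]] that by simp
  qed
  have rv: "random_variable borel (\<lambda>\<omega>. Y \<omega> i)" if "i \<in> {..<n}" for i
    using distributed_measurable[OF assms(2)[of i]] that by simp
  have "{..<n} \<noteq> {}" using \<open>n > 0\<close> by auto
  from indep_vars_iff_distr_eq_PiM'[OF this, of "\<lambda>i \<omega>. Y \<omega> i" "\<lambda>_. borel", OF rv] assms(3)
  have "distr M (PiM {..<n} (\<lambda>_. borel)) (\<lambda>\<omega>. \<lambda>i\<in>{..<n}. Y \<omega> i)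
      = PiM {..<n} (\<lambda>i. distr M borel (\<lambda>\<omega>. Y \<omega> i))" by blast
  also have "\<dots> = noise \<sigma> n" unfolding noise_def by (rule PiM_cong[OF refl d])
  finally show ?thesis .
qed

text \<open>Expanding the product of the factors \<open>r + 1\<close> over \<open>A\<close> gives
  one term per subset. It serves both the union bound over models and the total posterior
  mass.\<close>

lemma sum_Pow_power_card:
  fixes r :: real
  assumes "finite A"
  shows "(\<Sum>g\<in>Pow A - {{}}. r ^ card g) = (1 + r) ^ card A - 1"
proof -
  have "(\<Sum>g\<in>Pow A. r ^ card g) = (1 + r) ^ card A"
    using prod_add[OF assms, of "\<lambda>_. r" "\<lambda>_. 1"] by (simp add: add.commute)
  then show ?thesis using assms by (subst sum_diff1) auto
qed

text \<open>Union bound. A model of size k gets the threshold \<open>K ^ k\<close>, so its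
  probability is at most the k-th power of \<open>1 / (sqrt (1 - 2 * s) * K)\<close>, and these
  powers sum to a binomial expression. \<open>Q\<close> pays for the event that the noise norm is
  small.\<close>

lemma (in prob_space) fit_and_norm_tail:
  fixes x :: "'a \<Rightarrow> nat \<times> nat \<Rightarrow> real" and e :: "'a \<Rightarrow> nat \<Rightarrow> real"
  assumes ind: "indep_rv M (PiM ({..<n} \<times> {..<p}) (\<lambda>_. borel)) x (PiM {..<n} (\<lambda>_. borel)) e"
    and e: "distr M (PiM {..<n} (\<lambda>_. borel)) e = noise \<sigma> n"
    and \<sigma>: "\<sigma> > 0" and s: "r\<^sup>2 * \<sigma>\<^sup>2 = s" "s < 1/2" and K: "K > 0"
    and norm: "emeasure (noise \<sigma> n) {e \<in> space (noise \<sigma> n). (\<Sum>i<n. (e i)\<^sup>2) \<le> v} \<le> ennreal Q" and Q: "Q \<ge> 0"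
  defines "A \<equiv> {\<omega> \<in> space M. (\<exists>g\<in>Pow {..<p} - {{}}. 0 < gauss_mass n g (x \<omega>) \<and> gauss_mass n g (x \<omega>) < \<infinity> \<and>
      ennreal (K ^ card g) * gauss_mass n g (x \<omega>) \<le> fit_mass n g r (x \<omega>) (e \<omega>)) \<or> (\<Sum>i<n. (e \<omega> i)\<^sup>2) \<le> v}"
  shows "A \<in> sets M" "prob A \<le> (1 + 1 / (sqrt (1 - 2 * s) * K)) ^ p - 1 + Q"
proof -
  let ?X = "PiM ({..<n} \<times> {..<p}) (\<lambda>_. borel :: real measure)"
  let ?E = "PiM {..<n} (\<lambda>_. borel :: real measure)"
  have x[measurable]: "x \<in> measurable M ?X" and em[measurable]: "e \<in> measurable M ?E"
    using ind unfolding indep_rv_def by auto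
  define S where "S g = {z \<in> space (?X \<Otimes>\<^sub>M ?E). 0 < gauss_mass n g (fst z) \<and> gauss_mass n g (fst z) < \<infinity> \<and>
      ennreal (K ^ card g) * gauss_mass n g (fst z) \<le> fit_mass n g r (fst z) (snd z)}" for g
  define T where "T = {e \<in> space ?E. (\<Sum>i<n. (e i)\<^sup>2) \<le> v}"
  have S: "S g \<in> sets (?X \<Otimes>\<^sub>M ?E)" if "g \<in> Pow {..<p} - {{}}" for g
  proof -
    have g: "g \<subseteq> {..<p}" using that by auto
    note [measurable] = fit_mass_measurable[OF g] measurable_compose[OF measurable_fst gauss_mass_measurable[OF g]]
    show ?thesis unfolding S_def by measurable
  qed
  have "(\<lambda>e. e i) \<in> borel_measurable ?E" if "i < n" for i
  proof -
    have [measurable]: "i \<in> {..<n}" using that by simp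
    show ?thesis by measurable
  qed
  then have T: "T \<in> sets ?E" unfolding T_def by measurable
  define A1 where "A1 g = (\<lambda>\<omega>. (x \<omega>, e \<omega>)) -` S g \<inter> space M" for g
  define A2 where "A2 = e -` T \<inter> space M"
  have xs: "x \<omega> \<in> space ?X" "e \<omega> \<in> space ?E" if "\<omega> \<in> space M" for \<omega>
    using measurable_space[OF x that] measurable_space[OF em that] by auto
  have A_eq: "A = (\<Union>g\<in>Pow {..<p} - {{}}. A1 g) \<union> A2"
    unfolding A_def A1_def A2_def S_def T_def using xs by (auto simp: space_pair_measure)
  have A1: "A1 g \<in> sets M" if "g \<in> Pow {..<p} - {{}}" for g
    unfolding A1_def using S[OF that] by measurable
  have A2: "A2 \<in> sets M" unfolding A2_def using T by measurable
  show "A \<in> sets M" unfolding A_eq using A1 A2 by (intro sets.Un sets.finite_UN) auto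
  have p1: "prob (A1 g) \<le> (1 / (sqrt (1 - 2 * s) * K)) ^ card g" if g: "g \<in> Pow {..<p} - {{}}" for g
  proof -
    have g': "g \<subseteq> {..<p}" using g by auto
    interpret N: prob_space "noise \<sigma> n" by (rule prob_space_noise) fact
    interpret X: prob_space "distr M ?X x" by (rule prob_space_distr) fact
    have sets: "sets (distr M ?X x \<Otimes>\<^sub>M noise \<sigma> n) = sets (?X \<Otimes>\<^sub>M ?E)"
      by (intro sets_pair_measure_cong) (auto simp: sets_noise)
    have sp: "space (noise \<sigma> n) = space ?E" using sets_eq_imp_space_eq[OF sets_noise] .
    have "emeasure M (A1 g) = emeasure (distr M (?X \<Otimes>\<^sub>M ?E) (\<lambda>\<omega>. (x \<omega>, e \<omega>))) (S g)"
      unfolding A1_def using S[OF g] by (intro emeasure_distr[symmetric]) auto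
    also have "\<dots> = emeasure (distr M ?X x \<Otimes>\<^sub>M noise \<sigma> n) (S g)"
      unfolding indep_rv_distr_pair[OF ind] e ..
    also have "\<dots> = (\<integral>\<^sup>+ x'. emeasure (noise \<sigma> n) (Pair x' -` S g) \<partial>distr M ?X x)"
      by (rule N.emeasure_pair_measure_alt) (use S[OF g] sets in auto)
    \<comment> \<open>For each fixed design the noise section is bounded by a constant free of the
      design, so averaging over designs keeps the bound.\<close>
    also have "\<dots> \<le> (\<integral>\<^sup>+ x'. ennreal ((1 / sqrt (1 - 2 * s)) ^ card g / K ^ card g) \<partial>distr M ?X x)"
    proof (rule nn_integral_mono)
      fix x' assume "x' \<in> space (distr M ?X x)"
      then have x': "x' \<in> space ?X" by simp
      have "Pair x' -` S g = {e \<in> space (noise \<sigma> n). 0 < gauss_mass n g x' \<and> gauss_mass n g x' < \<infinity>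
        \<and> ennreal (K ^ card g) * gauss_mass n g x' \<le> fit_mass n g r x' e}"
        unfolding S_def sp using x' by (auto simp: space_pair_measure)
      then show "emeasure (noise \<sigma> n) (Pair x' -` S g) \<le> ennreal ((1 / sqrt (1 - 2 * s)) ^ card g / K ^ card g)"
        using noise_fit_mass_tail[OF g' \<sigma> s _ x', of "K ^ card g"] K by simp
    qed
    also have "\<dots> = ennreal ((1 / (sqrt (1 - 2 * s) * K)) ^ card g)"
      by (simp add: X.emeasure_space_1[simplified] power_divide power_mult_distrib)
    finally show ?thesis
      using K s unfolding emeasure_eq_measure by (subst (asm) ennreal_le_iff) (auto intro!: zero_le_power)
  qed
  have p2: "prob A2 \<le> Q"
  proof -
    have sp: "space (noise \<sigma> n) = space ?E" using sets_eq_imp_space_eq[OF sets_noise] .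
    have "emeasure M A2 = emeasure (noise \<sigma> n) T"
      unfolding A2_def e[symmetric] using T by (intro emeasure_distr[symmetric]) auto
    also have "\<dots> \<le> ennreal Q" using norm unfolding T_def sp .
    finally show ?thesis using Q unfolding emeasure_eq_measure by simp
  qed
  have "prob A \<le> prob (\<Union>g\<in>Pow {..<p} - {{}}. A1 g) + prob A2"
    unfolding A_eq using A1 A2 by (intro measure_Un_le sets.finite_UN) auto
  also have "prob (\<Union>g\<in>Pow {..<p} - {{}}. A1 g) \<le> (\<Sum>g\<in>Pow {..<p} - {{}}. prob (A1 g))"
    using A1 by (intro finite_measure_subadditive_finite) auto
  also have "\<dots> \<le> (\<Sum>g\<in>Pow {..<p} - {{}}. (1 / (sqrt (1 - 2 * s) * K)) ^ card g)"
    by (intro sum_mono p1)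
  also have "\<dots> = (1 + 1 / (sqrt (1 - 2 * s) * K)) ^ p - 1"
    by (subst sum_Pow_power_card) auto
  finally show "prob A \<le> (1 + 1 / (sqrt (1 - 2 * s) * K)) ^ p - 1 + Q" using p2 by linarith
qed

subsection \<open>Weight ratios\<close>

lemma power_powr_swap: "x > 0 \<Longrightarrow> (x ^ m) powr a = (x powr a) ^ m" for x a :: real
  by (simp add: powr_realpow[symmetric] powr_powr mult.commute)

lemma proj_mat_empty:
  assumes "X \<in> carrier_mat n p"
  shows "proj_mat X {} = 0\<^sub>m n n"
proof -
  have "Xsub X {} \<in> carrier_mat n 0" using Xsub_carrier[OF assms, of "{}"] by simp
  then show ?thesis unfolding proj_mat_def by (intro eq_matI) (auto simp: scalar_prod_def)
qed

lemma post_weight_empty: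
  assumes X: "X \<in> carrier_mat n p" and y: "y \<in> carrier_vec n"
  shows "post_weight \<nu> prior X y c {} = prior {} * (1 + y \<bullet> y) powr (- (real n + \<nu>) / 2)"
proof -
  have Xs: "Xsub X {} \<in> carrier_mat n 0" using Xsub_carrier[OF X, of "{}"] by simp
  have "dim_row (Sigma_sqrt_sub c {}) = 0" "dim_col (Sigma_sqrt_sub c {}) = 0"
    by (auto simp: Sigma_sqrt_sub_def)
  then have "W_mat X c {} \<in> carrier_mat 0 0" unfolding W_mat_def by auto
  then have W: "det (W_mat X c {}) = 1" by (rule det_dim_zero)
  \<comment> \<open>The inner dimension is 0, so every entry is an empty sum, whatever
    \<open>mat_inv\<close> returns.\<close>
  have "Xsub X {} * mat_inv (U_mat X c {}) * transpose_mat (Xsub X {}) = 0\<^sub>m n n"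
    using Xs by (intro eq_matI) (auto simp: scalar_prod_def)
  moreover have "(1\<^sub>m n - 0\<^sub>m n n) *\<^sub>v y = y"
  proof -
    have "1\<^sub>m n - 0\<^sub>m n n = (1\<^sub>m n :: real mat)" by (intro eq_matI) auto
    then show ?thesis using y by simp
  qed
  ultimately show ?thesis unfolding post_weight_def W using y by simp
qed

text \<open>With an empty true model the projection vanishes, and the matrix of the eigenvalue
  assumption is the Gram matrix of the columns scaled by 1 / sqrt n. Undoing the scaling multiplies
  the determinant by \<open>real n ^ card g\<close>.\<close>

lemma scaled_gram_lambda_min:
  assumes X: "X \<in> carrier_mat n p" and g: "g \<subseteq> {..<p}" and n: "n > 0" and l: "l \<ge> 0"
    and min: "lambda_min ((1 / real n) \<cdot>\<^sub>m (transpose_mat (Xsub X (g - {}))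
                  * (1\<^sub>m n - proj_mat X {}) * Xsub X (g - {}))) \<ge> l"
  shows "(real n * l) ^ card g \<le> det (transpose_mat (Xsub X g) * Xsub X g)"
proof -
  define A where "A = Xsub X g"
  have A: "A \<in> carrier_mat n (card g)" unfolding A_def by (rule Xsub_carrier[OF X g])
  define C where "C = (1 / sqrt (real n)) \<cdot>\<^sub>m A"
  have C: "C \<in> carrier_mat n (card g)" unfolding C_def using A by simp
  have "1\<^sub>m n - proj_mat X {} = 1\<^sub>m n" unfolding proj_mat_empty[OF X] by (intro eq_matI) auto
  then have "(1 / real n) \<cdot>\<^sub>m (transpose_mat (Xsub X (g - {})) * (1\<^sub>m n - proj_mat X {}) * Xsub X (g - {}))
      = (1 / real n) \<cdot>\<^sub>m (transpose_mat A * A)"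
    using A unfolding A_def by simp
  moreover have "transpose_mat C * C = (1 / real n) \<cdot>\<^sub>m (transpose_mat A * A)"
    using A n unfolding C_def
    by (intro eq_matI) (auto simp: scalar_prod_def sum_distrib_left)
  ultimately have "l \<le> lambda_min (transpose_mat C * C)" using min by simp
  from lambda_min_power_le_det_gram[OF C l this]
  have "l ^ card g \<le> (1 / real n) ^ card g * det (transpose_mat A * A)"
    unfolding \<open>transpose_mat C * C = _\<close> using A by simp
  then show ?thesis using n unfolding A_def by (simp add: power_mult_distrib field_simps)
qed

text \<open>The deterministic core. The determinant contributes (n l f)^(-|g|/2), the prior
  \<open>C0\<close>, and the quadratic forms at most P^(\<alpha>|g|/2). Here \<open>fit\<close>
  bounds the squared norm of the least squares fit by \<tau> per column, \<open>Y0\<close> bounds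
  |y|^2 from below, and \<open>bal\<close> makes \<tau> small enough for the exponent (n +
  \<nu>)/2.\<close>

lemma post_weight_ratio_le:
  fixes X :: "real mat" and y :: "real vec" and \<tau> Y0 :: real
  assumes X: "X \<in> carrier_mat n p" and y: "y \<in> carrier_vec n"
    and g: "g \<subseteq> {..<p}" and n: "n > 0" and l: "l > 0" and f: "f > 0"
    and c: "\<And>j. j < p \<Longrightarrow> f \<le> c j"
    and det: "(real n * l) ^ card g \<le> det (transpose_mat (Xsub X g) * Xsub X g)"
    and prior: "0 \<le> prior g" "prior g \<le> C0 * prior {}" and C0: "C0 > 0"
    and fit: "\<And>b. (\<And>a. (\<Sum>i<n. (\<Sum>j\<in>g. X $$ (i, j) * a j) * (y $ i - (\<Sum>j\<in>g. X $$ (i, j) * b j))) = 0) \<Longrightarrow>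
       (\<Sum>i<n. (\<Sum>j\<in>g. X $$ (i, j) * b j)\<^sup>2) \<le> \<tau> * card g"
    and \<tau>: "\<tau> \<ge> 0" and Y: "(\<Sum>i<n. (y $ i)\<^sup>2) \<ge> Y0" and Y0: "Y0 - \<tau> * p > 0" and \<nu>: "\<nu> > 0"
    and P: "P > 0" and bal: "(real n + \<nu>) / 2 * \<tau> \<le> \<alpha> / 2 * ln P * (Y0 - \<tau> * p)"
  shows "0 \<le> post_weight \<nu> prior X y c g"
    "post_weight \<nu> prior X y c g \<le> C0 * sqrt (P powr \<alpha> / (real n * l * f)) ^ card g * post_weight \<nu> prior X y c {}"
proof -
  have c': "\<And>j. j \<in> g \<Longrightarrow> f \<le> c j" using c g by auto
  define q where "q = y \<bullet> ((1\<^sub>m n - Xsub X g * mat_inv (U_mat X c g) * transpose_mat (Xsub X g)) *\<^sub>v y)"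
  have w: "post_weight \<nu> prior X y c g = det (W_mat X c g) powr (-1/2) * prior g * (1 + q) powr (- (real n + \<nu>) / 2)"
    unfolding post_weight_def q_def using y by simp
  show "0 \<le> post_weight \<nu> prior X y c g" unfolding w using prior by simp
  have nlf: "real n * l * f > 0" using n l f by simp
  have dpos: "det (transpose_mat (Xsub X g) * Xsub X g) > 0"
    using det n l by (meson less_le_trans mult_pos_pos of_nat_0_less_iff zero_less_power)
  have "(real n * l * f) ^ card g = f ^ card g * (real n * l) ^ card g" by (simp add: power_mult_distrib)
  also have "\<dots> \<le> f ^ card g * det (transpose_mat (Xsub X g) * Xsub X g)" using det f by simp
  also have "\<dots> \<le> det (W_mat X c g)" by (rule det_W_mat_ge[OF X g f c']) (use dpos in auto)
  finally have W: "(real n * l * f) ^ card g \<le> det (W_mat X c g)" .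
  have Wp: "det (W_mat X c g) powr (-1/2) \<le> ((real n * l * f) powr (-1/2)) ^ card g"
    using powr_mono2'[OF _ _ W, of "-1/2"] nlf by (simp add: power_powr_swap)
  define m where "m = real (card g)"
  have "card g \<le> p" using card_mono[OF _ g] by simp
  then have m: "0 \<le> m" "\<tau> * m \<le> \<tau> * p" unfolding m_def using \<tau> by (auto intro: mult_left_mono)
  define Y1 where "Y1 = (\<Sum>i<n. (y $ i)\<^sup>2)"
  have yy: "y \<bullet> y = Y1" unfolding Y1_def using y by (simp add: scalar_prod_def atLeast0LessThan power2_eq_square)
  obtain b0 where b0: "\<And>a. (\<Sum>i<n. (\<Sum>j\<in>g. X $$ (i, j) * a j) * (y $ i - (\<Sum>j\<in>g. X $$ (i, j) * b0 j))) = 0"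
    using normal_equations[OF X g _ y] dpos by force
  define T where "T = (\<Sum>i<n. (\<Sum>j\<in>g. X $$ (i, j) * b0 j)\<^sup>2)"
  have T: "T \<le> \<tau> * m" unfolding T_def m_def by (rule fit[OF b0])
  obtain b where b: "(\<Sum>i<n. (y $ i - (\<Sum>j\<in>g. X $$ (i, j) * b j))\<^sup>2) \<le> q"
    using quadratic_form_ge_residual[where c = c, OF X g f c' dpos y] unfolding q_def by auto
  \<comment> \<open>Pythagoras: no fit \<open>k\<close> has a smaller residual than the least
    squares fit \<open>h\<close>, whose residual is \<open>Y1 - T\<close>.\<close>
  have q: "Y1 - T \<le> q"
  proof -
    define h where "h i = (\<Sum>j\<in>g. X $$ (i, j) * b0 j)" for i
    define k where "k i = (\<Sum>j\<in>g. X $$ (i, j) * b j)" for i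
    have h: "(\<Sum>i<n. h i * (y $ i - h i)) = 0" "(\<Sum>i<n. k i * (y $ i - h i)) = 0"
      unfolding h_def k_def by (rule b0)+
    have "(\<Sum>i<n. (y $ i - k i)\<^sup>2) = (\<Sum>i<n. (y $ i)\<^sup>2 - (h i)\<^sup>2 + (h i - k i)\<^sup>2 + 2 * (h i * (y $ i - h i)) * 0
      - 2 * (k i * (y $ i - h i)))"
      by (intro sum.cong refl) (simp add: power2_eq_square algebra_simps)
    also have "\<dots> = Y1 - T + (\<Sum>i<n. (h i - k i)\<^sup>2) - 2 * (\<Sum>i<n. k i * (y $ i - h i))"
      unfolding Y1_def T_def h_def[symmetric] by (simp add: sum.distrib sum_subtractf sum_distrib_left)
    also have "\<dots> \<ge> Y1 - T" unfolding h by (simp add: sum_nonneg)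
    finally show ?thesis using b unfolding k_def by simp
  qed
  \<comment> \<open>Replacing \<open>card g\<close> by \<open>p\<close> gives a denominator that
    serves all models; 1 + x \<le> exp x then makes the bound exponential in the model size.\<close>
  define D where "D = Y0 - \<tau> * p"
  have D: "0 < D" "D \<le> 1 + Y1 - \<tau> * m" unfolding D_def using Y0 Y m unfolding Y1_def[symmetric] by linarith+
  have q1: "1 + Y1 - \<tau> * m \<le> 1 + q" using q T by linarith
  have q0: "0 < 1 + q" using D q1 by linarith
  have \<tau>m: "\<tau> * m \<ge> 0" using \<tau> m by simp
  have Y1: "1 + Y1 > 0" using D \<tau>m by linarith
  have "(1 + Y1) / (1 + q) \<le> (1 + Y1) / (1 + Y1 - \<tau> * m)"
    using q1 D Y1 by (intro divide_left_mono mult_pos_pos) auto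
  also have "\<dots> = 1 + \<tau> * m / (1 + Y1 - \<tau> * m)" using D by (simp add: field_simps)
  also have "\<dots> \<le> 1 + \<tau> * m / D" using D \<tau>m by (intro add_left_mono divide_left_mono mult_pos_pos) auto
  also have "\<dots> \<le> exp (\<tau> * m / D)" by (rule exp_ge_add_one_self)
  finally have r: "(1 + Y1) / (1 + q) \<le> exp (\<tau> * m / D)" .
  define H where "H = (real n + \<nu>) / 2"
  have H: "H > 0" using \<nu> by (simp add: H_def add_nonneg_pos)
  have "((1 + Y1) / (1 + q)) powr H \<le> exp (\<tau> * m / D) powr H"
    using r Y1 q0 H by (intro powr_mono2) auto
  also have "\<dots> = exp (H * \<tau> * m / D)" by (simp add: powr_def mult_ac)
  also have "H * \<tau> * m / D \<le> (\<alpha> / 2 * ln P * D) * m / D"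
    using bal D m unfolding H_def[symmetric] D_def[symmetric]
    by (intro divide_right_mono mult_right_mono) auto
  also have "\<dots> = m * (\<alpha> / 2 * ln P)" using D by simp
  also have "exp (m * (\<alpha> / 2 * ln P)) = (P powr (\<alpha> / 2)) ^ card g"
    unfolding m_def exp_of_nat_mult using P by (simp add: powr_def)
  finally have "((1 + Y1) / (1 + q)) powr H \<le> (P powr (\<alpha> / 2)) ^ card g" by simp
  moreover have "(1 + q) powr (- H) = ((1 + Y1) / (1 + q)) powr H * (1 + Y1) powr (- H)"
    using Y1 q0 by (simp add: powr_divide powr_minus field_simps)
  ultimately have Q: "(1 + q) powr (- H) \<le> (P powr (\<alpha> / 2)) ^ card g * (1 + Y1) powr (- H)"
    by (simp add: mult_right_mono)
  have pr: "prior {} \<ge> 0" using prior C0 by (smt (verit) mult_pos_neg)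
  have mH: "- (real n + \<nu>) / 2 = - H" unfolding H_def by (rule minus_divide_left[symmetric])
  have "post_weight \<nu> prior X y c g \<le>
    ((real n * l * f) powr (-1/2)) ^ card g * (C0 * prior {}) * ((P powr (\<alpha> / 2)) ^ card g * (1 + Y1) powr (- H))"
    unfolding w mH using Wp prior pr C0 Q by (intro mult_mono mult_nonneg_nonneg) auto
  also have "((real n * l * f) powr (-1/2)) ^ card g * (C0 * prior {}) * ((P powr (\<alpha> / 2)) ^ card g * (1 + Y1) powr (- H))
    = C0 * ((real n * l * f) powr (-1/2) * P powr (\<alpha> / 2)) ^ card g * (prior {} * (1 + Y1) powr (- H))"
    by (simp add: power_mult_distrib)
  also have "(real n * l * f) powr (-1/2) * P powr (\<alpha> / 2) = sqrt (P powr \<alpha> / (real n * l * f))"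
  proof -
    have "sqrt (P powr \<alpha>) = P powr (\<alpha> / 2)" using P by (simp add: powr_half_sqrt[symmetric] powr_powr)
    moreover have "(real n * l * f) powr (-1/2) = 1 / sqrt (real n * l * f)"
      using nlf by (simp add: powr_half_sqrt[symmetric] powr_minus_divide[of _ "1/2", simplified])
    ultimately show ?thesis by (simp add: real_sqrt_divide)
  qed
  also have "prior {} * (1 + Y1) powr (- H) = post_weight \<nu> prior X y c {}"
    unfolding post_weight_empty[OF X y] yy mH ..
  finally show "post_weight \<nu> prior X y c g \<le> C0 * sqrt (P powr \<alpha> / (real n * l * f)) ^ card g * post_weight \<nu> prior X y c {}" .
qed

text \<open>The normalising constant cancels in the ratio and is at least \<open>w {}\<close> in the
  sum. The last identity says that the posterior probabilities add up to 1.\<close>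

lemma posterior_bounds:
  fixes \<nu> prior X y c
  defines "w \<equiv> post_weight \<nu> prior X y c"
  assumes pos: "w {} > 0"
    and w: "\<And>g. g \<subseteq> {..<p} \<Longrightarrow> g \<noteq> {} \<Longrightarrow> 0 \<le> w g \<and> w g \<le> C0 * r ^ card g * w {}"
  shows "\<And>g. g \<subseteq> {..<p} \<Longrightarrow> g \<noteq> {} \<Longrightarrow> posterior p \<nu> prior X y c g / posterior p \<nu> prior X y c {} \<le> C0 * r ^ card g"
    and "(\<Sum>g\<in>Pow {..<p} - {{}}. posterior p \<nu> prior X y c g) \<le> C0 * ((1 + r) ^ p - 1)"
    and "\<bar>1 - posterior p \<nu> prior X y c {}\<bar> = (\<Sum>g\<in>Pow {..<p} - {{}}. posterior p \<nu> prior X y c g)"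
proof -
  define S where "S = (\<Sum>h\<in>Pow {..<p}. w h)"
  have S_eq: "S = w {} + (\<Sum>h\<in>Pow {..<p} - {{}}. w h)"
    unfolding S_def by (subst sum.remove[of _ "{}"]) auto
  have rest: "0 \<le> (\<Sum>h\<in>Pow {..<p} - {{}}. w h)" using w by (intro sum_nonneg) auto
  then have S: "S \<ge> w {}" "S > 0" using S_eq pos by auto
  have p: "posterior p \<nu> prior X y c g = w g / S" for g
    unfolding posterior_def S_def w_def ..
  show "posterior p \<nu> prior X y c g / posterior p \<nu> prior X y c {} \<le> C0 * r ^ card g"
    if "g \<subseteq> {..<p}" "g \<noteq> {}" for g
    unfolding p using w[OF that] pos S by (simp add: field_simps)
  have sum: "(\<Sum>g\<in>Pow {..<p} - {{}}. posterior p \<nu> prior X y c g) = (\<Sum>g\<in>Pow {..<p} - {{}}. w g) / S"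
    unfolding p by (simp add: sum_divide_distrib)
  also have "\<dots> \<le> (\<Sum>g\<in>Pow {..<p} - {{}}. w g) / w {}"
    using rest S pos by (intro divide_left_mono) auto
  also have "\<dots> \<le> (\<Sum>g\<in>Pow {..<p} - {{}}. C0 * r ^ card g * w {}) / w {}"
    using w pos by (intro divide_right_mono sum_mono) auto
  also have "\<dots> = C0 * ((1 + r) ^ p - 1)"
    using pos by (simp add: sum_distrib_right[symmetric] sum_distrib_left[symmetric] sum_Pow_power_card)
  finally show "(\<Sum>g\<in>Pow {..<p} - {{}}. posterior p \<nu> prior X y c g) \<le> C0 * ((1 + r) ^ p - 1)" .
  have "1 - posterior p \<nu> prior X y c {} = (\<Sum>g\<in>Pow {..<p} - {{}}. posterior p \<nu> prior X y c g)"
    unfolding sum unfolding p using S(2) S_eq by (simp add: field_simps)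
  moreover have "(\<Sum>g\<in>Pow {..<p} - {{}}. posterior p \<nu> prior X y c g) \<ge> 0"
    unfolding sum using rest S by simp
  ultimately show "\<bar>1 - posterior p \<nu> prior X y c {}\<bar> = (\<Sum>g\<in>Pow {..<p} - {{}}. posterior p \<nu> prior X y c g)"
    by simp
qed

subsection \<open>Asymptotics\<close>

text \<open>Covering sets are demanded for every \<open>n\<close>, but the inclusion holds only
  eventually; at the remaining indices the whole space is the cover, which leaves the limit
  unchanged.\<close>

lemma outer_prob_to_zero_mono:
  assumes M: "\<And>n. prob_space (M n)" and B: "outer_prob_to_zero M B"
    and sub: "eventually (\<lambda>n. B' n \<subseteq> B n) sequentially" and sp: "\<And>n. B' n \<subseteq> space (M n)"
  shows "outer_prob_to_zero M B'"
proof -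
  obtain A where A: "\<And>n. A n \<in> sets (M n)" "\<And>n. B n \<subseteq> A n" "(\<lambda>n. measure (M n) (A n)) \<longlonglongrightarrow> 0"
    using B unfolding outer_prob_to_zero_def by auto
  define A' where "A' n = (if B' n \<subseteq> B n then A n else space (M n))" for n
  have "eventually (\<lambda>n. measure (M n) (A n) = measure (M n) (A' n)) sequentially"
    using sub by eventually_elim (simp add: A'_def)
  then have "(\<lambda>n. measure (M n) (A' n)) \<longlonglongrightarrow> 0" using A(3) by (rule Lim_transform_eventually[rotated])
  moreover have "A' n \<in> sets (M n)" "B' n \<subseteq> A' n" for n
    using A(1,2)[of n] sp[of n] unfolding A'_def by auto
  ultimately show ?thesis unfolding outer_prob_to_zero_def by blast
qed

lemma one_plus_power_le_exp:
  fixes a :: real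
  assumes "a \<ge> 0"
  shows "(1 + a) ^ k \<le> exp (real k * a)"
  using assms by (simp add: exp_of_nat_mult power_mono)

section \<open>The regression setting with an empty true model\<close>

locale null_model_regression =
  fixes M :: "nat \<Rightarrow> 'a measure"
    and p :: "nat \<Rightarrow> nat"
    and X :: "nat \<Rightarrow> 'a \<Rightarrow> real mat"
    and eps :: "nat \<Rightarrow> 'a \<Rightarrow> real vec"
    and \<sigma>0 \<nu> C0 C3 \<delta> :: real
    and prior :: "nat \<Rightarrow> nat set \<Rightarrow> real"
    and phi_lo :: "nat \<Rightarrow> real"
  assumes prob: "\<And>n. prob_space (M n)"
    and dims: "\<And>n \<omega>. \<omega> \<in> space (M n) \<Longrightarrow> X n \<omega> \<in> carrier_mat n (p n)"
    and eps_dim: "\<And>n \<omega>. \<omega> \<in> space (M n) \<Longrightarrow> dim_vec (eps n \<omega>) = n"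
    and sigma0_pos: "\<sigma>0 > 0"
    and nu_pos: "\<nu> > 0"
    and eps_normal: "\<And>n i. i < n \<Longrightarrow>
          distributed (M n) lborel (\<lambda>\<omega>. vec_index (eps n \<omega>) i) (normal_density 0 \<sigma>0)"
    and eps_indep: "\<And>n. prob_space.indep_vars (M n) (\<lambda>_. borel) (\<lambda>i \<omega>. vec_index (eps n \<omega>) i) {..<n}"
    and X_indep: "\<And>n. indep_rv (M n)
          (PiM ({..<n} \<times> {..<p n}) (\<lambda>_. borel))
          (\<lambda>\<omega>. \<lambda>ij\<in>{..<n} \<times> {..<p n}. X n \<omega> $$ ij)
          (PiM {..<n} (\<lambda>_. borel))
          (\<lambda>\<omega>. \<lambda>i\<in>{..<n}. vec_index (eps n \<omega>) i)"
    and prior_nonneg: "\<And>n g. g \<subseteq> {..<p n} \<Longrightarrow> prior n g \<ge> 0"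
    and prior_sum: "\<And>n. (\<Sum>g\<in>Pow {..<p n}. prior n g) = 1"
    and C0_pos: "C0 > 0" and prior_le: "\<And>n g. g \<subseteq> {..<p n} \<Longrightarrow> prior n g \<le> C0 * prior n {}"
    and p_at_top: "filterlim p at_top sequentially"
    and p_ln_p: "(\<lambda>n. real (p n) * ln (real (p n))) \<in> o(\<lambda>n. real n)"
    and phi_lo_pos: "\<And>n. phi_lo n > 0"
    and C3_pos: "C3 > 0"
    and eigen_bound: "\<And>n. AE \<omega> in M n. \<forall>g. g \<subseteq> {..<p n} \<and> {} \<subseteq> g \<and> g \<noteq> {} \<longrightarrow>
               lambda_min ((1 / real n) \<cdot>\<^sub>m (transpose_mat (Xsub (X n \<omega>) (g - {}))
                  * (1\<^sub>m n - proj_mat (X n \<omega>) {}) * Xsub (X n \<omega>) (g - {})))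
               \<ge> C3 * real n powr (- \<delta>)"
begin

definition weight :: "nat \<Rightarrow> 'a \<Rightarrow> (nat \<Rightarrow> real) \<Rightarrow> nat set \<Rightarrow> real" where
  "weight n \<omega> = post_weight \<nu> (prior n) (X n \<omega>) (eps n \<omega>)"

text \<open>The factor in the weight ratio per included column. The denominator keeps the form n l f
  of \<open>post_weight_ratio_le\<close>, with l = C3 n^(-\<delta>) the eigenvalue bound.\<close>

definition rate :: "real \<Rightarrow> nat \<Rightarrow> real" where
  "rate \<alpha> n = sqrt (real (p n) powr \<alpha> / (real n * (C3 * real n powr (- \<delta>)) * phi_lo n))"

text \<open>The quantifier over \<open>c\<close> lies inside the event, so one event of high
  probability serves all hyperparameters and the suprema over them come for free.\<close>

definition dominated :: "real \<Rightarrow> nat \<Rightarrow> 'a \<Rightarrow> bool" where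
  "dominated \<alpha> n \<omega> \<longleftrightarrow> (\<forall>c. (\<forall>j<p n. phi_lo n \<le> c j) \<longrightarrow> weight n \<omega> c {} > 0 \<and>
     (\<forall>g. g \<subseteq> {..<p n} \<longrightarrow> g \<noteq> {} \<longrightarrow>
        0 \<le> weight n \<omega> c g \<and> weight n \<omega> c g \<le> C0 * rate \<alpha> n ^ card g * weight n \<omega> c {}))"

text \<open>If the null model had prior 0, \<open>prior_le\<close> would make every prior 0, against
  total mass 1.\<close>

lemma prior_empty_pos: "prior n {} > 0"
proof (rule ccontr)
  assume "\<not> prior n {} > 0"
  then have "prior n {} = 0" using prior_nonneg[of "{}" n] by simp
  then have "prior n g = 0" if "g \<in> Pow {..<p n}" for g
    using prior_nonneg[of g n] prior_le[of g n] that by simp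
  then show False using prior_sum[of n] by simp
qed

lemma eventually_p_pos: "eventually (\<lambda>n. p n > 0) sequentially"
  using p_at_top[unfolded filterlim_at_top, rule_format, of 1] by (simp add: Suc_le_eq)

lemma weight_empty_pos:
  assumes "\<omega> \<in> space (M n)"
  shows "weight n \<omega> c {} > 0"
proof -
  have y: "eps n \<omega> \<in> carrier_vec n" using eps_dim[OF assms] by (metis carrier_vec_dim_vec)
  have "0 \<le> scalar_prod (eps n \<omega>) (eps n \<omega>)" unfolding scalar_prod_def by (intro sum_nonneg) simp
  then have "1 + scalar_prod (eps n \<omega>) (eps n \<omega>) > 0" by linarith
  then show ?thesis
    unfolding weight_def post_weight_empty[OF dims[OF assms] y] using prior_empty_pos by simp
qed

text \<open>For a single outcome off the bad event, exp (r^2 T) stays below p^(s t |g|). As r^2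
  \<sigma>0^2 = s, this says T < \<tau> |g|, the input of the deterministic weight bound.\<close>

lemma dominated_off_tail_event:
  fixes s t \<tau> Y0 \<alpha> r :: real
  assumes \<omega>: "\<omega> \<in> space (M n)" and n: "n > 0" and p: "p n > 0"
    and eig: "\<forall>g. g \<subseteq> {..<p n} \<and> {} \<subseteq> g \<and> g \<noteq> {} \<longrightarrow>
               lambda_min ((1 / real n) \<cdot>\<^sub>m (transpose_mat (Xsub (X n \<omega>) (g - {}))
                  * (1\<^sub>m n - proj_mat (X n \<omega>) {}) * Xsub (X n \<omega>) (g - {})))
               \<ge> C3 * real n powr (- \<delta>)"
    and x: "x = (\<lambda>ij\<in>{..<n} \<times> {..<p n}. X n \<omega> $$ ij)" and e: "e = (\<lambda>i\<in>{..<n}. vec_index (eps n \<omega>) i)"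
    and fit: "\<And>g. g \<subseteq> {..<p n} \<Longrightarrow> g \<noteq> {} \<Longrightarrow> 0 < gauss_mass n g x \<Longrightarrow> gauss_mass n g x < \<infinity> \<Longrightarrow>
       fit_mass n g r x e < ennreal ((real (p n) powr (s * t)) ^ card g) * gauss_mass n g x"
    and norm: "Y0 \<le> (\<Sum>i<n. (e i)\<^sup>2)"
    and s: "r\<^sup>2 * \<sigma>0\<^sup>2 = s" "s > 0" and \<tau>: "\<tau> = \<sigma>0\<^sup>2 * t * ln (real (p n))" "\<tau> \<ge> 0"
    and Y0: "Y0 - \<tau> * p n > 0"
    and bal: "(real n + \<nu>) / 2 * \<tau> \<le> \<alpha> / 2 * ln (real (p n)) * (Y0 - \<tau> * p n)"
  shows "dominated \<alpha> n \<omega>"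
  unfolding dominated_def
proof (intro allI impI conjI)
  fix c assume c: "\<forall>j<p n. phi_lo n \<le> c j"
  show "weight n \<omega> c {} > 0" by (rule weight_empty_pos[OF \<omega>])
  fix g assume g: "g \<subseteq> {..<p n}" "g \<noteq> {}"
  have X: "X n \<omega> \<in> carrier_mat n (p n)" by (rule dims[OF \<omega>])
  have y: "eps n \<omega> \<in> carrier_vec n" using eps_dim[OF \<omega>] by (metis carrier_vec_dim_vec)
  define l where "l = C3 * real n powr (- \<delta>)"
  have l: "l > 0" unfolding l_def using C3_pos n by simp
  have det: "(real n * l) ^ card g \<le> det (transpose_mat (Xsub (X n \<omega>) g) * Xsub (X n \<omega>) g)"
    using scaled_gram_lambda_min[OF X g(1) n, of l] l eig g unfolding l_def by simp
  have "0 < (real n * l) ^ card g" using n l by simp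
  with det have det0: "det (transpose_mat (Xsub (X n \<omega>) g) * Xsub (X n \<omega>) g) \<noteq> 0" by linarith
  have fg: "finite g" using g finite_subset by blast
  have fitted: "fitted x g b i = (\<Sum>j\<in>g. X n \<omega> $$ (i, j) * b j)" if "i < n" for b i
    unfolding fitted_def x using that g(1) by (intro sum.cong) auto
  have Y: "Y0 \<le> (\<Sum>i<n. (vec_index (eps n \<omega>) i)\<^sup>2)" using norm unfolding e by simp
  obtain L where L: "L > 0" "\<And>b. (\<Sum>j\<in>g. (b j)\<^sup>2) \<le> L * (\<Sum>i<n. (\<Sum>j\<in>g. X n \<omega> $$ (i, j) * b j)\<^sup>2)"
    using coefficients_bounded_by_fit[OF X g(1) det0] by auto
  \<comment> \<open>The eigenvalue bound makes the Gram determinant nonzero, so the side conditions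
    of \<open>fit\<close> on \<open>gauss_mass\<close> hold.\<close>
  have G: "0 < gauss_mass n g x" "gauss_mass n g x < \<infinity>"
    by (rule gauss_mass_pos_finite[OF fg L(1)], use L(2) in \<open>simp add: fitted\<close>)+
  have fit': "(\<Sum>i<n. (\<Sum>j\<in>g. X n \<omega> $$ (i, j) * b j)\<^sup>2) \<le> \<tau> * card g"
    if b: "\<And>a. (\<Sum>i<n. (\<Sum>j\<in>g. X n \<omega> $$ (i, j) * a j) * (vec_index (eps n \<omega>) i - (\<Sum>j\<in>g. X n \<omega> $$ (i, j) * b j))) = 0" for b
  proof (rule ccontr)
    define T where "T = (\<Sum>i<n. (fitted x g b i)\<^sup>2)"
    assume "\<not> ?thesis"
    then have "\<tau> * card g < T" unfolding T_def by (simp add: fitted)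
    have r2: "r\<^sup>2 > 0" using s by (metis mult_zero_left less_irrefl zero_less_power2 zero_power2)
    have "s * t * ln (real (p n)) * card g = r\<^sup>2 * (\<tau> * card g)" unfolding \<tau>(1) s(1)[symmetric] by simp
    also have "\<dots> \<le> r\<^sup>2 * T" using \<open>\<tau> * card g < T\<close> r2 by simp
    finally have "exp (card g * (s * t * ln (real (p n)))) \<le> exp (r\<^sup>2 * T)" by (simp add: mult.commute)
    then have "(real (p n) powr (s * t)) ^ card g \<le> exp (r\<^sup>2 * T)"
      unfolding exp_of_nat_mult using p by (simp add: powr_def)
    then have "ennreal ((real (p n) powr (s * t)) ^ card g) * gauss_mass n g x \<le> ennreal (exp (r\<^sup>2 * T)) * gauss_mass n g x"
      by (intro mult_right_mono ennreal_leI) auto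
    also have "\<dots> = fit_mass n g r x e"
      unfolding T_def by (rule fit_mass_eq[OF fg, symmetric]) (use b in \<open>simp add: fitted e\<close>)
    finally show False using fit[OF g G] by simp
  qed
  have cc: "\<And>j. j < p n \<Longrightarrow> phi_lo n \<le> c j" using c by auto
  have P: "real (p n) > 0" using p by simp
  note * = post_weight_ratio_le[OF X y g(1) n l phi_lo_pos[of n] cc det prior_nonneg[OF g(1)] prior_le[OF g(1)] C0_pos
    fit' \<tau>(2) Y Y0 nu_pos P bal]
  show "0 \<le> weight n \<omega> c g" unfolding weight_def by (rule *(1))
  show "weight n \<omega> c g \<le> C0 * rate \<alpha> n ^ card g * weight n \<omega> c {}"
    unfolding weight_def rate_def l_def[symmetric] by (rule *(2))
qed

text \<open>This is the balance condition \<open>bal\<close> after cancelling \<sigma>0^2 ln p / 2.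
  It holds for large \<open>n\<close> because p ln p = o(n) and
  \<open>t < (1 - \<epsilon>) * \<alpha>\<close>.\<close>

lemma eventually_balanced:
  assumes t: "0 < t" "t < (1 - \<epsilon>) * \<alpha>" and \<alpha>: "\<alpha> > 0"
  shows "eventually (\<lambda>n. (real n + \<nu>) * t \<le> \<alpha> * ((1 - \<epsilon>) * n - t * (real (p n) * ln (real (p n))))) sequentially"
proof -
  \<comment> \<open>The slack \<open>d * n\<close> is split in halves: one absorbs the p ln p term,
    which explains the constant \<open>d / (2 * \<alpha> * t)\<close>, the other absorbs
    \<open>t * \<nu>\<close>.\<close>
  define d where "d = (1 - \<epsilon>) * \<alpha> - t"
  have d: "d > 0" unfolding d_def using t by simp
  have \<kappa>: "d / (2 * \<alpha> * t) > 0" using d t \<alpha> by simp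
  have "eventually (\<lambda>n. norm (real (p n) * ln (real (p n))) \<le> d / (2 * \<alpha> * t) * norm (real n)) sequentially"
    using landau_o.smallD[OF p_ln_p \<kappa>] .
  moreover have "eventually (\<lambda>n. real n \<ge> 2 * t * \<nu> / d) sequentially"
    using filterlim_real_sequentially by (simp add: filterlim_at_top)
  ultimately show ?thesis
  proof eventually_elim
    case (elim n)
    have "\<alpha> * t * (real (p n) * ln (real (p n))) \<le> \<alpha> * t * (d / (2 * \<alpha> * t) * real n)"
      using elim(1) \<alpha> t by (intro mult_left_mono) auto
    also have "\<dots> = d / 2 * n" using \<alpha> t by simp
    finally have 1: "\<alpha> * t * (real (p n) * ln (real (p n))) \<le> d / 2 * n" .
    have 2: "t * \<nu> \<le> d / 2 * n" using elim(2) d by (simp add: field_simps)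
    have "\<alpha> * ((1 - \<epsilon>) * n - t * (real (p n) * ln (real (p n)))) = (t + d) * n - \<alpha> * t * (real (p n) * ln (real (p n)))"
      unfolding d_def by (simp add: algebra_simps)
    also have "\<dots> \<ge> (real n + \<nu>) * t" using 1 2 by (simp add: algebra_simps)
    finally show ?case .
  qed
qed

text \<open>The power is at most exp (D p^(1 - a)), which tends to 1 because \<open>a > 1\<close>
  and \<open>p\<close> tends to infinity.\<close>

lemma tail_bound_tendsto_0:
  assumes "a > 1" "D \<ge> 0" "0 \<le> q" "q < 1"
  shows "(\<lambda>n. (1 + D / real (p n) powr a) ^ p n - 1 + q ^ n) \<longlonglongrightarrow> 0"
proof (rule tendsto_sandwich[OF _ _ tendsto_const])
  have "filterlim (\<lambda>n. real (p n)) at_top sequentially"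
    by (rule filterlim_compose[OF filterlim_real_sequentially p_at_top])
  then have "(\<lambda>n. real (p n) powr (1 - a)) \<longlonglongrightarrow> 0"
    using tendsto_neg_powr[of "1 - a"] assms by simp
  then have "(\<lambda>n. exp (D * real (p n) powr (1 - a)) - 1 + q ^ n) \<longlonglongrightarrow> exp (D * 0) - 1 + 0"
    using assms by (intro tendsto_intros LIMSEQ_realpow_zero)
  then show "(\<lambda>n. exp (D * real (p n) powr (1 - a)) - 1 + q ^ n) \<longlonglongrightarrow> 0" by simp
  have "eventually (\<lambda>n. p n \<ge> 1) sequentially" using p_at_top by (simp add: filterlim_at_top)
  then show "eventually (\<lambda>n. (1 + D / real (p n) powr a) ^ p n - 1 + q ^ n
      \<le> exp (D * real (p n) powr (1 - a)) - 1 + q ^ n) sequentially"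
  proof eventually_elim
    case (elim n)
    have "real (p n) * (D / real (p n) powr a) = D * real (p n) powr (1 - a)"
      using elim by (simp add: powr_diff)
    then show ?case using one_plus_power_le_exp[of "D / real (p n) powr a" "p n"] assms by simp
  qed
  show "eventually (\<lambda>n. 0 \<le> (1 + D / real (p n) powr a) ^ p n - 1 + q ^ n) sequentially"
    using assms by (intro always_eventually allI add_nonneg_nonneg) (auto intro!: one_le_power)
qed

lemma dominated_with_high_probability:
  assumes \<alpha>: "\<alpha> > 2"
  shows "outer_prob_to_zero M (\<lambda>n. {\<omega> \<in> space (M n). \<not> dominated \<alpha> n \<omega>})"
proof -
  \<comment> \<open>The constants are midpoints: \<open>t\<close> lies between 2 and \<alpha>, which
    leaves room for \<open>s\<close> between 1/t and 1/2. Then \<open>s < 1/2\<close> keeps the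
    moment generating function finite and \<open>s * t > 1\<close> makes the union bound vanish;
    \<epsilon> is chosen so that (1 - \<epsilon>) \<alpha> is halfway between \<open>t\<close> and
    \<alpha>.\<close>
  define t where "t = (\<alpha> + 2) / 2"
  have t: "2 < t" "t < \<alpha>" using \<alpha> by (auto simp: t_def)
  define s where "s = (1 / t + 1 / 2) / 2"
  have "1 / t < 1 / 2" using t by (simp add: field_simps)
  then have s: "1 / t < s" "s < 1 / 2" by (auto simp: s_def)
  have "1 / t * t < s * t" using s(1) t by (intro mult_strict_right_mono) auto
  then have st: "s * t > 1" using t by simp
  have "1 / t > 0" using t by simp
  then have s0: "s > 0" using s(1) by linarith
  define \<epsilon> where "\<epsilon> = (\<alpha> - t) / (2 * \<alpha>)"
  have "(1 - \<epsilon>) * \<alpha> = (\<alpha> + t) / 2" unfolding \<epsilon>_def using \<alpha> by (simp add: field_simps)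
  then have \<epsilon>: "0 < \<epsilon>" "\<epsilon> < 1" "t < (1 - \<epsilon>) * \<alpha>"
    using t \<alpha> unfolding \<epsilon>_def by simp_all
  define r where "r = sqrt s / \<sigma>0"
  have r: "r\<^sup>2 * \<sigma>0\<^sup>2 = s" using s0 sigma0_pos by (simp add: r_def power_divide)
  obtain q where q: "0 \<le> q" "q < 1"
    "\<And>n. emeasure (noise \<sigma>0 n) {e \<in> space (noise \<sigma>0 n). (\<Sum>i<n. (e i)\<^sup>2) \<le> (1 - \<epsilon>) * n * \<sigma>0\<^sup>2} \<le> ennreal (q ^ n)"
    by (rule noise_norm_lower_tail[OF sigma0_pos \<epsilon>(1,2)]) (rule that)
  define x where "x n \<omega> = (\<lambda>ij\<in>{..<n} \<times> {..<p n}. X n \<omega> $$ ij)" for n \<omega>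
  define e where "e n \<omega> = (\<lambda>i\<in>{..<n}. vec_index (eps n \<omega>) i)" for n \<omega>
  define K where "K n = real (p n) powr (s * t)" for n
  define D where "D = 1 / sqrt (1 - 2 * s)"
  have D: "D \<ge> 0" using s by (simp add: D_def)
  define A where "A n = {\<omega> \<in> space (M n). (\<exists>g\<in>Pow {..<p n} - {{}}. 0 < gauss_mass n g (x n \<omega>) \<and> gauss_mass n g (x n \<omega>) < \<infinity> \<and>
      ennreal (K n ^ card g) * gauss_mass n g (x n \<omega>) \<le> fit_mass n g r (x n \<omega>) (e n \<omega>))
      \<or> (\<Sum>i<n. (e n \<omega> i)\<^sup>2) \<le> (1 - \<epsilon>) * n * \<sigma>0\<^sup>2}" for n
  define E where "E n \<omega> \<longleftrightarrow> (\<forall>g. g \<subseteq> {..<p n} \<and> {} \<subseteq> g \<and> g \<noteq> {} \<longrightarrow>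
               lambda_min ((1 / real n) \<cdot>\<^sub>m (transpose_mat (Xsub (X n \<omega>) (g - {}))
                  * (1\<^sub>m n - proj_mat (X n \<omega>) {}) * Xsub (X n \<omega>) (g - {})))
               \<ge> C3 * real n powr (- \<delta>))" for n \<omega>
  \<comment> \<open>The outcomes violating the eigenvalue bound are covered by a measurable null
    set, which can be added to the bad event.\<close>
  have "\<exists>N. {\<omega> \<in> space (M n). \<not> E n \<omega>} \<subseteq> N \<and> emeasure (M n) N = 0 \<and> N \<in> sets (M n)" for n
    using eigen_bound[of n] unfolding E_def[symmetric] by (elim AE_E) blast
  then obtain N where N: "\<And>n. {\<omega> \<in> space (M n). \<not> E n \<omega>} \<subseteq> N n" "\<And>n. emeasure (M n) (N n) = 0" "\<And>n. N n \<in> sets (M n)"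
    by metis
  have tail: "A n \<in> sets (M n)" "measure (M n) (A n) \<le> (1 + D / K n) ^ p n - 1 + q ^ n" if n: "n > 0" "p n > 0" for n
  proof -
    interpret prob_space "M n" by (rule prob)
    have e_distr: "distr (M n) (PiM {..<n} (\<lambda>_. borel)) (e n) = noise \<sigma>0 n"
      unfolding e_def[abs_def] by (rule distr_eq_noise) (use n eps_normal eps_indep in auto)
    have ind: "indep_rv (M n) (PiM ({..<n} \<times> {..<p n}) (\<lambda>_. borel)) (x n) (PiM {..<n} (\<lambda>_. borel)) (e n)"
      unfolding x_def[abs_def] e_def[abs_def] by (rule X_indep)
    have K: "K n > 0" using n by (simp add: K_def)
    note * = fit_and_norm_tail[OF ind e_distr sigma0_pos r s(2) K q(3) zero_le_power[OF q(1)]]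
    show "A n \<in> sets (M n)" unfolding A_def by (rule *(1))
    show "measure (M n) (A n) \<le> (1 + D / K n) ^ p n - 1 + q ^ n"
      using *(2) unfolding A_def D_def by simp
  qed
  define good where "good n \<longleftrightarrow> n > 0 \<and> p n > 0 \<and>
    (real n + \<nu>) * t \<le> \<alpha> * ((1 - \<epsilon>) * n - t * (real (p n) * ln (real (p n))))" for n
  have ev: "eventually good sequentially"
    unfolding good_def
    using eventually_gt_at_top[of 0] eventually_p_pos
      eventually_balanced[of t \<epsilon> \<alpha>] t \<alpha> \<epsilon>(3)
    by (auto intro!: eventually_conj)
  \<comment> \<open>At the finitely many indices that are not good the cover is the whole
    space.\<close>
  define A' where "A' n = (if good n then A n \<union> N n else space (M n))" for n
  have "A' n \<in> sets (M n)" for n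
    using tail(1)[of n] N(3) unfolding A'_def good_def by auto
  moreover have "{\<omega> \<in> space (M n). \<not> dominated \<alpha> n \<omega>} \<subseteq> A' n" for n
  proof (cases "good n")
    case True
    then have n: "n > 0" "p n > 0"
      and b: "(real n + \<nu>) * t \<le> \<alpha> * ((1 - \<epsilon>) * n - t * (real (p n) * ln (real (p n))))"
      unfolding good_def by auto
    define \<tau> where "\<tau> = \<sigma>0\<^sup>2 * t * ln (real (p n))"
    define Y0 where "Y0 = (1 - \<epsilon>) * n * \<sigma>0\<^sup>2"
    define B where "B = (1 - \<epsilon>) * n - t * (real (p n) * ln (real (p n)))"
    have lnp: "ln (real (p n)) \<ge> 0" using n by simp
    have Yt: "Y0 - \<tau> * p n = \<sigma>0\<^sup>2 * B" unfolding Y0_def \<tau>_def B_def by (simp add: algebra_simps)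
    have "0 < (real n + \<nu>) * t" using n nu_pos t by simp
    then have "0 < \<alpha> * B" using b unfolding B_def by linarith
    then have B: "B > 0" using \<alpha> by (simp add: zero_less_mult_iff)
    have Yt0: "Y0 - \<tau> * p n > 0" unfolding Yt using B sigma0_pos by simp
    have \<tau>0: "\<tau> \<ge> 0" unfolding \<tau>_def using lnp t by simp
    have "(real n + \<nu>) / 2 * \<tau> = (\<sigma>0\<^sup>2 * ln (real (p n)) / 2) * ((real n + \<nu>) * t)" unfolding \<tau>_def by simp
    also have "\<dots> \<le> (\<sigma>0\<^sup>2 * ln (real (p n)) / 2) * (\<alpha> * B)"
      using b lnp unfolding B_def by (intro mult_left_mono) auto
    also have "\<dots> = \<alpha> / 2 * ln (real (p n)) * (Y0 - \<tau> * p n)" unfolding Yt by simp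
    finally have bal: "(real n + \<nu>) / 2 * \<tau> \<le> \<alpha> / 2 * ln (real (p n)) * (Y0 - \<tau> * p n)" .
    have "dominated \<alpha> n \<omega>" if "\<omega> \<in> space (M n)" "\<omega> \<notin> A n" "\<omega> \<notin> N n" for \<omega>
    proof (rule dominated_off_tail_event[OF that(1) n _ x_def e_def])
      show "\<forall>g. g \<subseteq> {..<p n} \<and> {} \<subseteq> g \<and> g \<noteq> {} \<longrightarrow>
               lambda_min ((1 / real n) \<cdot>\<^sub>m (transpose_mat (Xsub (X n \<omega>) (g - {}))
                  * (1\<^sub>m n - proj_mat (X n \<omega>) {}) * Xsub (X n \<omega>) (g - {})))
               \<ge> C3 * real n powr (- \<delta>)"
        using N(1)[of n] that unfolding E_def[symmetric] by auto
      show "fit_mass n g r (x n \<omega>) (e n \<omega>) < ennreal ((real (p n) powr (s * t)) ^ card g) * gauss_mass n g (x n \<omega>)"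
        if "g \<subseteq> {..<p n}" "g \<noteq> {}" "0 < gauss_mass n g (x n \<omega>)" "gauss_mass n g (x n \<omega>) < \<infinity>" for g
        using \<open>\<omega> \<notin> A n\<close> \<open>\<omega> \<in> space (M n)\<close> that unfolding A_def K_def by (auto simp: not_le)
      show "Y0 \<le> (\<Sum>i<n. (e n \<omega> i)\<^sup>2)"
        using that unfolding A_def Y0_def by auto
    qed (fact r s0 \<tau>_def \<tau>0 Yt0 bal)+
    then show ?thesis using True unfolding A'_def by auto
  qed (auto simp: A'_def)
  moreover have "(\<lambda>n. measure (M n) (A' n)) \<longlonglongrightarrow> 0"
  proof (rule tendsto_sandwich[OF _ _ tendsto_const])
    show "(\<lambda>n. (1 + D / K n) ^ p n - 1 + q ^ n) \<longlonglongrightarrow> 0"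
      unfolding K_def by (rule tail_bound_tendsto_0) (use st D q in auto)
    show "eventually (\<lambda>n. measure (M n) (A' n) \<le> (1 + D / K n) ^ p n - 1 + q ^ n) sequentially"
      using ev
    proof eventually_elim
      case (elim n)
      then have n: "n > 0" "p n > 0" unfolding good_def by auto
      have "measure (M n) (A n \<union> N n) \<le> measure (M n) (A n) + measure (M n) (N n)"
        using tail(1)[OF n] N(3) by (rule measure_Un_le)
      also have "measure (M n) (N n) = 0" using N(2)[of n] by (simp add: measure_def)
      finally show ?case using tail(2)[OF n] elim by (simp add: A'_def)
    qed
  qed (auto intro!: always_eventually)
  ultimately show ?thesis unfolding outer_prob_to_zero_def by (intro exI[of _ A']) auto
qed

section \<open>From the rate to posterior consistency\<close>

lemma rate_nonneg: "rate \<alpha> n \<ge> 0"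
  unfolding rate_def using C3_pos less_imp_le[OF phi_lo_pos[of n]] by simp

text \<open>Moving p^k under the root raises the exponent of \<open>p\<close> by 2 k. Taking
  \<open>k = 0\<close> serves the maximal ratio and \<open>k = 1\<close> the total mass, whence the
  \<open>\<alpha> + 2\<close> in the stronger growth condition.\<close>

lemma scaled_rate_tendsto_0:
  assumes k: "k \<ge> 0"
    and "(\<lambda>n. real (p n) powr (\<alpha> + 2 * k)) \<in> o(\<lambda>n. real n powr (1 - \<delta>) * phi_lo n)"
  shows "(\<lambda>n. real (p n) powr k * rate \<alpha> n) \<longlonglongrightarrow> 0"
proof -
  have "(\<lambda>n. real (p n) powr (\<alpha> + 2 * k) / (real n powr (1 - \<delta>) * phi_lo n)) \<longlonglongrightarrow> 0"
    using assms by (intro smalloD_tendsto) 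
  then have "(\<lambda>n. sqrt (1 / C3 * (real (p n) powr (\<alpha> + 2 * k) / (real n powr (1 - \<delta>) * phi_lo n)))) \<longlonglongrightarrow> sqrt (1 / C3 * 0)"
    by (intro tendsto_intros)
  moreover have "eventually (\<lambda>n. sqrt (1 / C3 * (real (p n) powr (\<alpha> + 2 * k) / (real n powr (1 - \<delta>) * phi_lo n)))
      = real (p n) powr k * rate \<alpha> n) sequentially"
    using eventually_gt_at_top[of 0] eventually_p_pos
  proof eventually_elim
    case (elim n)
    have "real n powr (1 - \<delta>) = real n * real n powr (- \<delta>)" using elim by (simp add: powr_diff powr_minus field_simps)
    moreover have "real (p n) powr (\<alpha> + 2 * k) = real (p n) powr \<alpha> * (real (p n) powr k)\<^sup>2"
      using elim by (simp add: powr_add powr_power mult.commute)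
    ultimately have "1 / C3 * (real (p n) powr (\<alpha> + 2 * k) / (real n powr (1 - \<delta>) * phi_lo n))
      = (real (p n) powr k)\<^sup>2 * (real (p n) powr \<alpha> / (real n * (C3 * real n powr (- \<delta>)) * phi_lo n))"
      by (simp add: field_simps)
    then show ?case unfolding rate_def by (simp only: real_sqrt_mult) simp
  qed
  ultimately show ?thesis by (auto intro: Lim_transform_eventually)
qed

lemma dominated_posterior:
  assumes "dominated \<alpha> n \<omega>" and c: "\<forall>j<p n. phi_lo n \<le> c j"
  shows "\<And>g. g \<subseteq> {..<p n} \<Longrightarrow> g \<noteq> {} \<Longrightarrow>
      posterior (p n) \<nu> (prior n) (X n \<omega>) (eps n \<omega>) c g / posterior (p n) \<nu> (prior n) (X n \<omega>) (eps n \<omega>) c {}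
        \<le> C0 * rate \<alpha> n ^ card g"
    and "(\<Sum>g\<in>Pow {..<p n} - {{}}. posterior (p n) \<nu> (prior n) (X n \<omega>) (eps n \<omega>) c g)
        \<le> C0 * ((1 + rate \<alpha> n) ^ p n - 1)"
    and "\<bar>1 - posterior (p n) \<nu> (prior n) (X n \<omega>) (eps n \<omega>) c {}\<bar>
        = (\<Sum>g\<in>Pow {..<p n} - {{}}. posterior (p n) \<nu> (prior n) (X n \<omega>) (eps n \<omega>) c g)"
proof -
  have d: "0 < post_weight \<nu> (prior n) (X n \<omega>) (eps n \<omega>) c {}"
    "\<And>g. g \<subseteq> {..<p n} \<Longrightarrow> g \<noteq> {} \<Longrightarrow> 0 \<le> post_weight \<nu> (prior n) (X n \<omega>) (eps n \<omega>) c g \<and>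
      post_weight \<nu> (prior n) (X n \<omega>) (eps n \<omega>) c g \<le> C0 * rate \<alpha> n ^ card g * post_weight \<nu> (prior n) (X n \<omega>) (eps n \<omega>) c {}"
    using assms unfolding dominated_def weight_def by auto
  note posterior_bounds[OF d]
  then show "\<And>g. g \<subseteq> {..<p n} \<Longrightarrow> g \<noteq> {} \<Longrightarrow>
      posterior (p n) \<nu> (prior n) (X n \<omega>) (eps n \<omega>) c g / posterior (p n) \<nu> (prior n) (X n \<omega>) (eps n \<omega>) c {}
        \<le> C0 * rate \<alpha> n ^ card g"
    and "(\<Sum>g\<in>Pow {..<p n} - {{}}. posterior (p n) \<nu> (prior n) (X n \<omega>) (eps n \<omega>) c g)
        \<le> C0 * ((1 + rate \<alpha> n) ^ p n - 1)"
    and "\<bar>1 - posterior (p n) \<nu> (prior n) (X n \<omega>) (eps n \<omega>) c {}\<bar>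
        = (\<Sum>g\<in>Pow {..<p n} - {{}}. posterior (p n) \<nu> (prior n) (X n \<omega>) (eps n \<omega>) c g)"
    by blast+
qed

lemma subset_not_dominated:
  assumes "\<And>\<omega> c. dominated \<alpha> n \<omega> \<Longrightarrow> \<forall>j < p n. phi_lo n \<le> c j \<Longrightarrow> \<not> P \<omega> c"
  shows "{\<omega> \<in> space (M n). \<exists>c. (\<forall>j < p n. phi_lo n \<le> c j \<and> c j \<le> phi_hi n) \<and> P \<omega> c}
    \<subseteq> {\<omega> \<in> space (M n). \<not> dominated \<alpha> n \<omega>}"
  using assms by blast

lemma max_ratio_to_zero:
  assumes \<alpha>: "\<alpha> > 2" and small: "(\<lambda>n. real (p n) powr \<alpha>) \<in> o(\<lambda>n. real n powr (1 - \<delta>) * phi_lo n)"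
    and \<eta>: "\<eta> > 0"
  shows "outer_prob_to_zero M (\<lambda>n. {\<omega> \<in> space (M n). \<exists>c. (\<forall>j < p n. phi_lo n \<le> c j \<and> c j \<le> phi_hi n) \<and>
              (\<exists>g. g \<subseteq> {..<p n} \<and> g \<noteq> {} \<and>
                 posterior (p n) \<nu> (prior n) (X n \<omega>) (eps n \<omega>) c g
                 / posterior (p n) \<nu> (prior n) (X n \<omega>) (eps n \<omega>) c {} > \<eta>)})"
proof (rule outer_prob_to_zero_mono[OF prob dominated_with_high_probability[OF \<alpha>]])
  have "(\<lambda>n. real (p n) powr 0 * rate \<alpha> n) \<longlonglongrightarrow> 0"
    by (rule scaled_rate_tendsto_0) (use small in auto)
  moreover have "eventually (\<lambda>n. real (p n) powr 0 * rate \<alpha> n = rate \<alpha> n) sequentially"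
    using eventually_p_pos by eventually_elim simp
  ultimately have lim: "rate \<alpha> \<longlonglongrightarrow> 0" by (rule Lim_transform_eventually)
  \<comment> \<open>Once the rate is below 1, models with a single column are the worst case, since
    a nonempty \<open>g\<close> has \<open>card g \<ge> 1\<close>.\<close>
  have "eventually (\<lambda>n. rate \<alpha> n < 1) sequentially" using order_tendstoD(2)[OF lim] by simp
  moreover have "eventually (\<lambda>n. rate \<alpha> n < \<eta> / C0) sequentially"
    using order_tendstoD(2)[OF lim] \<eta> C0_pos by simp
  ultimately show "eventually (\<lambda>n. {\<omega> \<in> space (M n). \<exists>c. (\<forall>j < p n. phi_lo n \<le> c j \<and> c j \<le> phi_hi n) \<and>
              (\<exists>g. g \<subseteq> {..<p n} \<and> g \<noteq> {} \<and>
                 posterior (p n) \<nu> (prior n) (X n \<omega>) (eps n \<omega>) c g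
                 / posterior (p n) \<nu> (prior n) (X n \<omega>) (eps n \<omega>) c {} > \<eta>)}
      \<subseteq> {\<omega> \<in> space (M n). \<not> dominated \<alpha> n \<omega>}) sequentially"
  proof eventually_elim
    case (elim n)
    show ?case
    proof (rule subset_not_dominated, rule notI, elim exE conjE)
      fix \<omega> c g
      assume d: "dominated \<alpha> n \<omega>" and c: "\<forall>j < p n. phi_lo n \<le> c j" and g: "g \<subseteq> {..<p n}" "g \<noteq> {}"
        and large: "posterior (p n) \<nu> (prior n) (X n \<omega>) (eps n \<omega>) c g
          / posterior (p n) \<nu> (prior n) (X n \<omega>) (eps n \<omega>) c {} > \<eta>"
      have "finite g" using g finite_subset by blast
      then have "card g \<ge> 1" using g by (simp add: Suc_le_eq card_gt_0_iff)
      then have "rate \<alpha> n ^ card g \<le> rate \<alpha> n"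
        using power_decreasing[of 1 "card g" "rate \<alpha> n"] rate_nonneg[of \<alpha> n] elim by simp
      then have "C0 * rate \<alpha> n ^ card g \<le> C0 * (\<eta> / C0)" using elim C0_pos by (intro mult_left_mono) auto
      also have "\<dots> = \<eta>" using C0_pos by simp
      finally show False using dominated_posterior(1)[OF d c g] large by linarith
    qed
  qed
qed auto

text \<open>The total mass is at most C0 ((1 + r)^p - 1) \<le> C0 (exp (p r) - 1) with r the rate,
  so p r must tend to 0. The second claim follows since the distance of the null posterior from 1 is
  that same mass.\<close>

lemma total_mass_to_zero:
  assumes \<alpha>: "\<alpha> > 2" and small: "(\<lambda>n. real (p n) powr (\<alpha> + 2)) \<in> o(\<lambda>n. real n powr (1 - \<delta>) * phi_lo n)"
    and \<eta>: "\<eta> > 0"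
  shows "outer_prob_to_zero M (\<lambda>n. {\<omega> \<in> space (M n). \<exists>c. (\<forall>j < p n. phi_lo n \<le> c j \<and> c j \<le> phi_hi n) \<and>
              (\<Sum>g\<in>Pow {..<p n} - {{}}. posterior (p n) \<nu> (prior n) (X n \<omega>) (eps n \<omega>) c g) > \<eta>})" (is ?th1)
    and "outer_prob_to_zero M (\<lambda>n. {\<omega> \<in> space (M n). \<exists>c. (\<forall>j < p n. phi_lo n \<le> c j \<and> c j \<le> phi_hi n) \<and>
              \<bar>1 - posterior (p n) \<nu> (prior n) (X n \<omega>) (eps n \<omega>) c {}\<bar> > \<eta>})" (is ?th2)
proof -
  have "(\<lambda>n. real (p n) powr 1 * rate \<alpha> n) \<longlonglongrightarrow> 0"
    by (rule scaled_rate_tendsto_0) (use small in auto)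
  then have "(\<lambda>n. C0 * (exp (real (p n) * rate \<alpha> n) - 1)) \<longlonglongrightarrow> C0 * (exp 0 - 1)"
    by (intro tendsto_intros) simp
  then have lim: "eventually (\<lambda>n. C0 * (exp (real (p n) * rate \<alpha> n) - 1) < \<eta>) sequentially"
    using \<eta> by (intro order_tendstoD(2)) auto
  have bound: "(\<Sum>g\<in>Pow {..<p n} - {{}}. posterior (p n) \<nu> (prior n) (X n \<omega>) (eps n \<omega>) c g) < \<eta>"
    if "C0 * (exp (real (p n) * rate \<alpha> n) - 1) < \<eta>" "dominated \<alpha> n \<omega>" "\<forall>j < p n. phi_lo n \<le> c j" for n \<omega> c
  proof -
    have "(\<Sum>g\<in>Pow {..<p n} - {{}}. posterior (p n) \<nu> (prior n) (X n \<omega>) (eps n \<omega>) c g) \<le> C0 * ((1 + rate \<alpha> n) ^ p n - 1)"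
      by (rule dominated_posterior(2)[OF that(2,3)])
    also have "\<dots> \<le> C0 * (exp (real (p n) * rate \<alpha> n) - 1)"
      using one_plus_power_le_exp[OF rate_nonneg, of \<alpha> n "p n"] C0_pos by (intro mult_left_mono) auto
    finally show ?thesis using that(1) by simp
  qed
  show ?th1
  proof (rule outer_prob_to_zero_mono[OF prob dominated_with_high_probability[OF \<alpha>]])
    show "eventually (\<lambda>n. {\<omega> \<in> space (M n). \<exists>c. (\<forall>j < p n. phi_lo n \<le> c j \<and> c j \<le> phi_hi n) \<and>
              (\<Sum>g\<in>Pow {..<p n} - {{}}. posterior (p n) \<nu> (prior n) (X n \<omega>) (eps n \<omega>) c g) > \<eta>}
      \<subseteq> {\<omega> \<in> space (M n). \<not> dominated \<alpha> n \<omega>}) sequentially"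
      using lim
    proof eventually_elim
      case (elim n)
      show ?case
      proof (rule subset_not_dominated)
        fix \<omega> c assume "dominated \<alpha> n \<omega>" "\<forall>j < p n. phi_lo n \<le> c j"
        from bound[OF elim this]
        show "\<not> (\<Sum>g\<in>Pow {..<p n} - {{}}. posterior (p n) \<nu> (prior n) (X n \<omega>) (eps n \<omega>) c g) > \<eta>"
          by linarith
      qed
    qed
  qed auto
  show ?th2
  proof (rule outer_prob_to_zero_mono[OF prob dominated_with_high_probability[OF \<alpha>]])
    show "eventually (\<lambda>n. {\<omega> \<in> space (M n). \<exists>c. (\<forall>j < p n. phi_lo n \<le> c j \<and> c j \<le> phi_hi n) \<and>
              \<bar>1 - posterior (p n) \<nu> (prior n) (X n \<omega>) (eps n \<omega>) c {}\<bar> > \<eta>}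
      \<subseteq> {\<omega> \<in> space (M n). \<not> dominated \<alpha> n \<omega>}) sequentially"
      using lim
    proof eventually_elim
      case (elim n)
      show ?case
      proof (rule subset_not_dominated)
        fix \<omega> c assume d: "dominated \<alpha> n \<omega>" "\<forall>j < p n. phi_lo n \<le> c j"
        from bound[OF elim d] dominated_posterior(3)[OF d]
        show "\<not> \<bar>1 - posterior (p n) \<nu> (prior n) (X n \<omega>) (eps n \<omega>) c {}\<bar> > \<eta>" by linarith
      qed
    qed
  qed auto
qed

end

theorem theorem2p2:
  fixes M :: "nat \<Rightarrow> 'a measure"
    and p :: "nat \<Rightarrow> nat"
    and X :: "nat \<Rightarrow> 'a \<Rightarrow> real mat"
    and eps :: "nat \<Rightarrow> 'a \<Rightarrow> real vec"
    and \<sigma>0 \<nu> C0 C3 \<delta> \<delta>0 :: real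
    and prior :: "nat \<Rightarrow> nat set \<Rightarrow> real"
    and phi_lo phi_hi :: "nat \<Rightarrow> real"
  assumes prob: "\<And>n. prob_space (M n)"
    and dims: "\<And>n \<omega>. \<omega> \<in> space (M n) \<Longrightarrow> X n \<omega> \<in> carrier_mat n (p n)"
    and eps_dim: "\<And>n \<omega>. \<omega> \<in> space (M n) \<Longrightarrow> dim_vec (eps n \<omega>) = n"
    and sigma0_pos: "\<sigma>0 > 0"
    and nu_pos: "\<nu> > 0"
    \<comment> \<open>epsilon ~ N(0, sigma0^2 I_n): i.i.d. N(0, sigma0^2) coordinates\<close>
    and eps_normal: "\<And>n i. i < n \<Longrightarrow>
          distributed (M n) lborel (\<lambda>\<omega>. eps n \<omega> $ i) (normal_density 0 \<sigma>0)"
    and eps_indep: "\<And>n. prob_space.indep_vars (M n) (\<lambda>_. borel) (\<lambda>i \<omega>. eps n \<omega> $ i) {..<n}"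
    \<comment> \<open>design independent of the noise (deterministic designs are a special case)\<close>
    and X_indep: "\<And>n. indep_rv (M n)
          (PiM ({..<n} \<times> {..<p n}) (\<lambda>_. borel))
          (\<lambda>\<omega>. \<lambda>ij\<in>{..<n} \<times> {..<p n}. X n \<omega> $$ ij)
          (PiM {..<n} (\<lambda>_. borel))
          (\<lambda>\<omega>. \<lambda>i\<in>{..<n}. eps n \<omega> $ i)"
    \<comment> \<open>all X_gamma^T X_gamma invertible a.s.\<close>
    and X_inv: "\<And>n. AE \<omega> in M n. \<forall>g \<subseteq> {..<p n}.
          invertible_mat (transpose_mat (Xsub (X n \<omega>) g) * Xsub (X n \<omega>) g)"
    \<comment> \<open>prior on models: a probability distribution on subsets of {..<p}\<close>
    and prior_nonneg: "\<And>n g. g \<subseteq> {..<p n} \<Longrightarrow> prior n g \<ge> 0"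
    and prior_sum: "\<And>n. (\<Sum>g\<in>Pow {..<p n}. prior n g) = 1"
    \<comment> \<open>A1 (true model gamma^0 = empty)\<close>
    and A1: "C0 > 0" "\<And>n g. g \<subseteq> {..<p n} \<Longrightarrow> prior n g \<le> C0 * prior n {}"
    \<comment> \<open>A5 (s_n = 0)\<close>
    and A5: "filterlim p at_top sequentially" "\<And>n. p n \<le> n"
            "(\<lambda>n. real (p n) * ln (real (p n))) \<in> o(\<lambda>n. real n)"
    \<comment> \<open>A6\<close>
    and A6: "\<delta>0 > 0" "phi_hi \<in> O(\<lambda>n. real n powr \<delta>0)"
    \<comment> \<open>A7 (k_n = 0, so k_n = O(phi_lo) holds trivially)\<close>
    and A7: "\<And>n. phi_lo n > 0"
    \<comment> \<open>A8 (gamma^0 = empty, so S_1 = nonempty models and P_{gamma^0} = 0)\<close>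
    and A8: "C3 > 0" "\<delta> \<ge> 0"
            "filterlim (\<lambda>n. real n powr (1 - \<delta>) * phi_lo n) at_top sequentially"
            "\<And>n. AE \<omega> in M n. \<forall>g. g \<subseteq> {..<p n} \<and> {} \<subseteq> g \<and> g \<noteq> {} \<longrightarrow>
               lambda_min ((1 / real n) \<cdot>\<^sub>m (transpose_mat (Xsub (X n \<omega>) (g - {}))
                  * (1\<^sub>m n - proj_mat (X n \<omega>) {}) * Xsub (X n \<omega>) (g - {})))
               \<ge> C3 * real n powr (- \<delta>)"
  shows
    "((\<exists>\<alpha>0 > 2. (\<lambda>n. real (p n) powr \<alpha>0) \<in> o(\<lambda>n. real n powr (1 - \<delta>) * phi_lo n)) \<longrightarrow>
       (\<forall>\<eta> > 0. outer_prob_to_zero M (\<lambda>n. {\<omega> \<in> space (M n).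
          \<exists>c. (\<forall>j < p n. phi_lo n \<le> c j \<and> c j \<le> phi_hi n) \<and>
              (\<exists>g. g \<subseteq> {..<p n} \<and> g \<noteq> {} \<and>
                 posterior (p n) \<nu> (prior n) (X n \<omega>) (eps n \<omega>) c g
                 / posterior (p n) \<nu> (prior n) (X n \<omega>) (eps n \<omega>) c {} > \<eta>)})))
     \<and>
     ((\<exists>\<alpha>0 > 2. (\<lambda>n. real (p n) powr (\<alpha>0 + 2)) \<in> o(\<lambda>n. real n powr (1 - \<delta>) * phi_lo n)) \<longrightarrow>
       (\<forall>\<eta> > 0. outer_prob_to_zero M (\<lambda>n. {\<omega> \<in> space (M n).
          \<exists>c. (\<forall>j < p n. phi_lo n \<le> c j \<and> c j \<le> phi_hi n) \<and>
              (\<Sum>g\<in>Pow {..<p n} - {{}}. posterior (p n) \<nu> (prior n) (X n \<omega>) (eps n \<omega>) c g) > \<eta>}))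
       \<and>
       (\<forall>\<eta> > 0. outer_prob_to_zero M (\<lambda>n. {\<omega> \<in> space (M n).
          \<exists>c. (\<forall>j < p n. phi_lo n \<le> c j \<and> c j \<le> phi_hi n) \<and>
              \<bar>1 - posterior (p n) \<nu> (prior n) (X n \<omega>) (eps n \<omega>) c {}\<bar> > \<eta>})))"
proof -
  interpret null_model_regression M p X eps \<sigma>0 \<nu> C0 C3 \<delta> prior phi_lo
    by (rule null_model_regression.intro)
      (fact prob dims eps_dim sigma0_pos nu_pos eps_normal eps_indep X_indep prior_nonneg prior_sum
        A1 A5 A7 A8)+
  show ?thesis
    by (intro conjI impI allI; elim exE conjE) (rule max_ratio_to_zero total_mass_to_zero; assumption)+
qed

end
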